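(* Let $q:\mathbf{C}^n\to\mathbf{C}$ be a holomorphic polynomial such that $q(0)=0$ and $|q(z)|<1$ for all $z$ in the closed unit ball in $\mathbf{C}^n$. Then there is some integer $N$ and a holomorphic polynomial mapping $p:\mathbf{C}^n\to\mathbf{C}^N$ such that $\dfrac{p}{1+q}$ is a proper rational mapping from the unit ball $B_n$ to the unit ball $B_N$ that is reduced to lowest terms, in the sense that $1+q$ does not divide all the components of the numerator $p$.
   Context: $B_k$ denotes the open unit ball in $\mathbf{C}^k$. Divisibility is in the ring of holomorphic polynomials on $\mathbf{C}^n$. In the trivial case where $q$ is identically zero, the denominator is the constant $1$ and the lowest-terms condition is regarded as vacuous. *)

theory Defs
  imports "HOL-Analysis.Analysis"
begin

definition holomorphic_polynomial :: "(complex ^ 'n \<Rightarrow> complex) \<Rightarrow> bool" where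
  "holomorphic_polynomial f \<longleftrightarrow>
     (\<exists>(A :: ('n \<Rightarrow> nat) set) c. finite A \<and> f = (\<lambda>z. \<Sum>\<alpha>\<in>A. c \<alpha> * (\<Prod>j\<in>UNIV. (z $ j) ^ \<alpha> j)))"

definition polynomial_divides :: "(complex ^ 'n \<Rightarrow> complex) \<Rightarrow> (complex ^ 'n \<Rightarrow> complex) \<Rightarrow> bool" where
  "polynomial_divides g f \<longleftrightarrow> (\<exists>h. holomorphic_polynomial h \<and> f = (\<lambda>z. g z * h z))"

text \<open>Since the target dimension \<open>N\<close> is existentially quantified, it cannot be a type:
  \<open>\<complex>\<^sup>N\<close> is the set of sequences vanishing from index \<open>N\<close> on, as in the library's
  \<^const>\<open>Euclidean_space\<close>. The product topology on sequences induces the Euclidean topology on it.\<close>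

definition complex_space :: "nat \<Rightarrow> (nat \<Rightarrow> complex) set" where
  "complex_space N = {w. \<forall>i\<ge>N. w i = 0}"

definition complex_ball :: "nat \<Rightarrow> (nat \<Rightarrow> complex) set" where
  "complex_ball N = {w \<in> complex_space N. (\<Sum>i<N. (cmod (w i))\<^sup>2) < 1}"

definition holomorphic_polynomial_mapping :: "nat \<Rightarrow> (complex ^ 'n \<Rightarrow> nat \<Rightarrow> complex) \<Rightarrow> bool" where
  "holomorphic_polynomial_mapping N p \<longleftrightarrow>
     p \<in> UNIV \<rightarrow> complex_space N \<and> (\<forall>i<N. holomorphic_polynomial (\<lambda>z. p z i))"

text \<open>The library's \<^const>\<open>proper_map\<close> asks for a closed map with compact fibres and does not
  include continuity. For continuous maps into \<open>B\<^sub>N\<close> it is the usual condition that preimages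
  of compact sets are compact.\<close>

lemma proper_map_complex_ball_iff:
  fixes f :: "'a::metric_space \<Rightarrow> nat \<Rightarrow> complex"
  assumes "continuous_map (top_of_set S) (top_of_set (complex_ball N)) f"
  shows "proper_map (top_of_set S) (top_of_set (complex_ball N)) f \<longleftrightarrow>
         (\<forall>K. K \<subseteq> complex_ball N \<and> compact K \<longrightarrow> compact {x \<in> S. f x \<in> K})"
proof -
  let ?Y = "top_of_set (complex_ball N)"
  have met: "metrizable_space ?Y"
    by (simp add: metrizable_space_euclidean metrizable_space_subtopology)
  have "proper_map (top_of_set S) ?Y f \<longleftrightarrow>
      f \<in> topspace (top_of_set S) \<rightarrow> topspace ?Y \<and>
      (\<forall>K. compactin ?Y K \<longrightarrow>
         compactin (top_of_set S) {x \<in> topspace (top_of_set S). f x \<in> K})"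
  proof
    assume "proper_map (top_of_set S) ?Y f"
    then show "f \<in> topspace (top_of_set S) \<rightarrow> topspace ?Y \<and>
      (\<forall>K. compactin ?Y K \<longrightarrow>
         compactin (top_of_set S) {x \<in> topspace (top_of_set S). f x \<in> K})"
      using continuous_map_funspace[OF assms] by (simp add: proper_map_alt)
  next
    assume "f \<in> topspace (top_of_set S) \<rightarrow> topspace ?Y \<and>
      (\<forall>K. compactin ?Y K \<longrightarrow>
         compactin (top_of_set S) {x \<in> topspace (top_of_set S). f x \<in> K})"
    then show "proper_map (top_of_set S) ?Y f"
      using assms met
      by (intro compact_imp_proper_map)
         (auto intro: metrizable_imp_k_space Hausdorff_imp_kc_space metrizable_imp_Hausdorff_space)
  qed
  moreover have "f \<in> S \<rightarrow> complex_ball N"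
    using continuous_map_funspace[OF assms] by simp
  ultimately show ?thesis
    by (auto simp: compactin_subtopology)
qed

end

theory Submission
  imports Defs "HOL-Computational_Algebra.Fundamental_Theorem_Algebra"
begin

text \<open>
  Choose \<open>s < 1\<close> with \<open>|q| < s\<close> on the closed ball. On polynomials, consider the inner product for
  which the monomials are orthogonal with \<open>\<parallel>z\<^sup>\<alpha>\<parallel>\<^sup>2 = \<alpha>! / (|\<alpha>| + n)!\<close>, a multiple of the Bergman inner
  product of the ball. Multiplication by \<open>q\<close>, as a map from degree less than \<open>L\<close> to degree less than
  \<open>L + d\<close>, has norm at most \<open>s\<close>: average over the torus by Parseval and integrate the squared moduli
  of the coordinates over the simplex. The reproducing kernel of the polynomials of degree less than
  \<open>L\<close> is \<open>K\<^sub>L = \<Sum>\<^bsub>k<L\<^esub> (k + n)!/k! \<parallel>z\<parallel>\<^bsup>2k\<^esup>\<close>, so the norm bound says that \<open>K\<^bsub>L+d\<^esub> - |q|\<^sup>2 K\<^sub>L / s\<^sup>2\<close> is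
  positive semidefinite, hence a squared norm \<open>\<parallel>g\<parallel>\<^sup>2\<close> of a polynomial mapping. On the sphere the
  kernels are constants whose ratio tends to \<open>1\<close> as \<open>L\<close> grows, and so \<open>1 - |q|\<^sup>2 / s\<close> is a squared norm
  on the sphere. Thus \<open>q / \<surd>s\<close> is a component of a polynomial proper map between balls, and composing
  this map with an automorphism of the target produces the denominator \<open>1 + q\<close>. The first numerator
  is \<open>\<surd>s + q / \<surd>s\<close>, which is a nonzero constant modulo \<open>1 + q\<close>.
\<close>

section \<open>Positive semidefinite forms\<close>

text \<open>Isolates the index \<open>c\<close>, so that the square in \<open>x c\<close> can be
  completed in the induction that follows.\<close>

lemma hermitian_form_insert:
  fixes h :: "'a \<Rightarrow> 'a \<Rightarrow> complex"
  assumes "finite A" "c \<notin> A" and herm: "\<And>a. a \<in> A \<Longrightarrow> h c a = cnj (h a c)"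
  shows "(\<Sum>a\<in>insert c A. \<Sum>b\<in>insert c A. x a * cnj (x b) * h a b) =
    x c * cnj (x c) * h c c + x c * cnj (\<Sum>a\<in>A. x a * h a c) + cnj (x c) * (\<Sum>a\<in>A. x a * h a c)
      + (\<Sum>a\<in>A. \<Sum>b\<in>A. x a * cnj (x b) * h a b)"
proof -
  have "(\<Sum>b\<in>A. x c * cnj (x b) * h c b) = x c * cnj (\<Sum>a\<in>A. x a * h a c)"
    by (simp add: cnj_sum sum_distrib_left herm mult.assoc)
  moreover have "(\<Sum>a\<in>A. x a * cnj (x c) * h a c) = cnj (x c) * (\<Sum>a\<in>A. x a * h a c)"
    by (simp add: sum_distrib_left mult_ac)
  ultimately show ?thesis
    using assms(1,2) by (simp add: sum.distrib algebra_simps)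
qed

text \<open>Cholesky elimination, one index at a time: removing the rank-one part carried by column
  \<open>c\<close> leaves the Schur complement, which is again positive semidefinite and falls under
  the induction hypothesis. If the diagonal entry at \<open>c\<close> is zero, positivity forces the
  whole column to vanish.\<close>

lemma positive_semidefinite_decomposition:
  fixes h :: "'a \<Rightarrow> 'a \<Rightarrow> complex"
  assumes "finite A" and "\<And>a b. a \<in> A \<Longrightarrow> b \<in> A \<Longrightarrow> h b a = cnj (h a b)"
    and "\<And>x. 0 \<le> Re (\<Sum>a\<in>A. \<Sum>b\<in>A. x a * cnj (x b) * h a b)"
  shows "\<exists>v. \<forall>a\<in>A. \<forall>b\<in>A. h a b = (\<Sum>i\<in>A. v i a * cnj (v i b))"
  using assms
proof (induction A arbitrary: h rule: finite_induct)
  case empty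
  then show ?case by simp
next
  case (insert c A)
  have herm: "h c a = cnj (h a c)" if "a \<in> A" for a
    using insert.prems(1)[of a c] that by simp
  have form: "0 \<le> Re (x c * cnj (x c) * h c c + x c * cnj (\<Sum>a\<in>A. x a * h a c)
      + cnj (x c) * (\<Sum>a\<in>A. x a * h a c) + (\<Sum>a\<in>A. \<Sum>b\<in>A. x a * cnj (x b) * h a b))" for x
    using insert.prems(2)[of x]
    by (simp only: hermitian_form_insert[OF insert.hyps(1,2), of h, OF herm])
  have "Im (h c c) = 0"
    using insert.prems(1)[of c c] by (simp add: complex_eq_iff)
  then obtain D where D: "h c c = of_real D"
    by (metis complex_is_Real_iff Reals_cases)
  have "D \<ge> 0"
  proof -
    define x :: "'a \<Rightarrow> complex" where "x a = (if a = c then 1 else 0)" for a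
    have "x a = 0" if "a \<in> A" for a using that insert.hyps by (auto simp: x_def)
    then have "(\<Sum>a\<in>A. x a * h a c) = 0" "(\<Sum>a\<in>A. \<Sum>b\<in>A. x a * cnj (x b) * h a b) = 0"
      by (auto intro!: sum.neutral)
    moreover have "x c = 1" by (simp add: x_def)
    ultimately show ?thesis
      using form[of x] by (simp add: D)
  qed
  define S where "S x = (\<Sum>a\<in>A. x a * h a c)" for x
  \<comment> \<open>The Schur complement of the entry at \<open>c\<close>. For \<open>D = 0\<close>
    there is nothing to subtract, as \<open>zero\<close> shows below.\<close>
  define h' where "h' a b = (if D = 0 then h a b else h a b - h a c * h c b / of_real D)" for a b
  have zero: "h a c = 0" if "D = 0" "a \<in> A" for a
  proof (rule ccontr)
    assume nz: "h a c \<noteq> 0"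
    \<comment> \<open>The test vector has entry 1 at \<open>a\<close> and \<open>- R * h a c\<close>
      at \<open>c\<close>. With \<open>D = 0\<close> the form takes the value
      \<open>h a a - 2 * R * |h a c|^2\<close> there, and this \<open>R\<close> makes it -1.\<close>
    define R where "R = (Re (h a a) + 1) / (2 * (cmod (h a c))\<^sup>2)"
    define x where "x b = (if b = c then - of_real R * h a c else if b = a then 1 else 0)" for b
    have ne: "a \<noteq> c" using that insert.hyps by auto
    have "S x = (\<Sum>b\<in>A. if b = a then h b c else 0)"
      unfolding S_def x_def using insert.hyps by (intro sum.cong) auto
    then have Sx: "S x = h a c" using insert.hyps that by simp
    have "(\<Sum>b\<in>A. \<Sum>e\<in>A. x b * cnj (x e) * h b e) = (\<Sum>b\<in>A. if b = a then (\<Sum>e\<in>A. if e = a then h b e else 0) else 0)"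
    proof (rule sum.cong[OF refl])
      fix b assume "b \<in> A"
      have "x e = (if e = a then 1 else 0)" if "e \<in> A" for e
        using that insert.hyps by (auto simp: x_def)
      then show "(\<Sum>e\<in>A. x b * cnj (x e) * h b e) = (if b = a then (\<Sum>e\<in>A. if e = a then h b e else 0) else 0)"
        using \<open>b \<in> A\<close> by (auto intro!: sum.cong)
    qed
    moreover have "(\<Sum>e\<in>A. if e = a then h a e else 0) = h a a"
      using insert.hyps that by simp
    ultimately have Qx: "(\<Sum>b\<in>A. \<Sum>e\<in>A. x b * cnj (x e) * h b e) = h a a"
      using insert.hyps that by simp
    have "0 \<le> Re (x c * cnj (h a c) + cnj (x c) * h a c + h a a)"
      using form[of x] unfolding S_def[symmetric] Sx Qx D that by simp
    also have "\<dots> = - 2 * R * (cmod (h a c))\<^sup>2 + Re (h a a)"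
      unfolding x_def cmod_power2 by (simp add: algebra_simps power2_eq_square)
    also have "\<dots> = -1"
      using nz by (simp add: R_def field_simps)
    finally show False by simp
  qed
  have "\<exists>v. \<forall>a\<in>A. \<forall>b\<in>A. h' a b = (\<Sum>i\<in>A. v i a * cnj (v i b))"
  proof (rule insert.IH)
    show "h' b a = cnj (h' a b)" if "a \<in> A" "b \<in> A" for a b
      using that insert.prems(1)[of a b] insert.prems(1)[of a c] insert.prems(1)[of b c]
      by (simp add: h'_def)
    show "0 \<le> Re (\<Sum>a\<in>A. \<Sum>b\<in>A. x a * cnj (x b) * h' a b)" for x
    proof (cases "D = 0")
      case True
      define y where "y = x(c := 0)"
      have "(\<Sum>a\<in>A. \<Sum>b\<in>A. x a * cnj (x b) * h a b) = (\<Sum>a\<in>A. \<Sum>b\<in>A. y a * cnj (y b) * h a b)"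
        using insert.hyps by (intro sum.cong) (auto simp: y_def)
      with form[of y] True show ?thesis
        by (simp add: h'_def y_def)
    next
      case False
      \<comment> \<open>the choice of \<open>y c\<close> that minimises the form, so that its value is the Schur complement at \<open>x\<close>\<close>
      define y where "y = x(c := - S x / of_real D)"
      have yx: "y a = x a" if "a \<in> A" for a
        using that insert.hyps by (auto simp: y_def)
      have Sy: "(\<Sum>a\<in>A. y a * h a c) = S x"
        by (simp add: S_def yx)
      have Q: "(\<Sum>a\<in>A. \<Sum>b\<in>A. y a * cnj (y b) * h a b) = (\<Sum>a\<in>A. \<Sum>b\<in>A. x a * cnj (x b) * h a b)"
        by (intro sum.cong) (auto simp: yx)
      have "cnj (S x) = (\<Sum>b\<in>A. cnj (x b) * h c b)"
        by (simp add: S_def cnj_sum herm)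
      then have "S x * cnj (S x) / of_real D = (\<Sum>a\<in>A. \<Sum>b\<in>A. x a * h a c * (cnj (x b) * h c b) / of_real D)"
        unfolding S_def by (simp only: sum_product sum_divide_distrib)
      then have "(\<Sum>a\<in>A. \<Sum>b\<in>A. x a * cnj (x b) * h' a b) =
          (\<Sum>a\<in>A. \<Sum>b\<in>A. x a * cnj (x b) * h a b) - S x * cnj (S x) / of_real D"
        using False by (simp add: h'_def sum_subtractf [symmetric] algebra_simps)
      also have "\<dots> = y c * cnj (y c) * h c c + y c * cnj (S x) + cnj (y c) * S x
            + (\<Sum>a\<in>A. \<Sum>b\<in>A. x a * cnj (x b) * h a b)"
        using False by (simp add: y_def D field_simps)
      finally show ?thesis
        using form[of y] unfolding Sy Q by simp
    qed
  qed
  then obtain v where v: "\<And>a b. a \<in> A \<Longrightarrow> b \<in> A \<Longrightarrow> h' a b = (\<Sum>i\<in>A. v i a * cnj (v i b))"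
    by blast
  \<comment> \<open>Row \<open>c\<close> is the eliminated column, normalised; the other rows are
    those of \<open>v\<close>, extended by zero at \<open>c\<close>. If \<open>D = 0\<close>,
    division by zero makes row \<open>c\<close> vanish, in agreement with
    \<open>zero\<close>.\<close>
  define w where "w i a = (if i = c then h a c / of_real (sqrt D) else if a = c then 0 else v i a)" for i a
  have w_A: "(\<Sum>i\<in>A. w i a * cnj (w i b)) = (if a = c \<or> b = c then 0 else \<Sum>i\<in>A. v i a * cnj (v i b))" for a b
    using insert.hyps by (auto simp: w_def intro!: sum.cong sum.neutral)
  have sq: "of_real (sqrt D) * of_real (sqrt D) = (of_real D :: complex)"
    using \<open>D \<ge> 0\<close> by (simp flip: of_real_mult)
  have w_c: "w c a * cnj (w c b) = h a c * cnj (h b c) / of_real D" for a b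
    by (simp add: w_def sq)
  have "h a b = (\<Sum>i\<in>insert c A. w i a * cnj (w i b))" if "a \<in> insert c A" "b \<in> insert c A" for a b
    using that insert.hyps herm[of a] herm[of b] v[of a b] zero[of a] zero[of b] D
    by (cases "D = 0") (auto simp: w_A w_c h'_def diff_eq_eq add.commute)
  then show ?case by blast
qed

text \<open>A matrix and its transpose have the same norm. With \<open>y\<close> the image of
  \<open>x\<close> under the transpose and \<open>u\<close> the image of the conjugate of
  \<open>y\<close> under \<open>T\<close>, the squared norm of \<open>y\<close> is the pairing of
  \<open>x\<close> with \<open>u\<close>. Cauchy-Schwarz and the bound for \<open>u\<close> then
  allow one factor to be cancelled.\<close>

lemma transpose_bound:
  fixes T :: "'b \<Rightarrow> 'a \<Rightarrow> complex"
  assumes "\<And>f. (\<Sum>b\<in>B. (cmod (\<Sum>a\<in>A. T b a * f a))\<^sup>2) \<le> s\<^sup>2 * (\<Sum>a\<in>A. (cmod (f a))\<^sup>2)"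
  shows "(\<Sum>a\<in>A. (cmod (\<Sum>b\<in>B. T b a * x b))\<^sup>2) \<le> s\<^sup>2 * (\<Sum>b\<in>B. (cmod (x b))\<^sup>2)"
proof -
  define y where "y a = (\<Sum>b\<in>B. T b a * x b)" for a
  define u where "u b = (\<Sum>a\<in>A. T b a * cnj (y a))" for b
  define Y where "Y = (\<Sum>a\<in>A. (cmod (y a))\<^sup>2)"
  define X where "X = (\<Sum>b\<in>B. (cmod (x b))\<^sup>2)"
  have "Y \<ge> 0" "X \<ge> 0" by (simp_all add: X_def Y_def sum_nonneg)
  have "complex_of_real Y = (\<Sum>a\<in>A. \<Sum>b\<in>B. T b a * x b * cnj (y a))"
    by (simp add: Y_def complex_norm_square y_def[of _] sum_distrib_right flip: of_real_power)
  also have "\<dots> = (\<Sum>b\<in>B. x b * u b)"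
    by (subst sum.swap) (simp add: u_def sum_distrib_left mult_ac)
  finally have "Y = cmod (\<Sum>b\<in>B. x b * u b)"
    using \<open>Y \<ge> 0\<close> by (metis norm_of_real abs_of_nonneg)
  also have "\<dots> \<le> (\<Sum>b\<in>B. cmod (x b) * cmod (u b))"
    by (rule order_trans[OF norm_sum]) (simp add: norm_mult)
  finally have "Y\<^sup>2 \<le> (\<Sum>b\<in>B. cmod (x b) * cmod (u b))\<^sup>2"
    using \<open>Y \<ge> 0\<close> by (intro power_mono) auto
  also have "\<dots> \<le> X * (\<Sum>b\<in>B. (cmod (u b))\<^sup>2)"
    unfolding X_def by (rule Cauchy_Schwarz_ineq_sum)
  also have "\<dots> \<le> X * (s\<^sup>2 * Y)"
    using assms[of "\<lambda>a. cnj (y a)"] \<open>X \<ge> 0\<close>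
    by (intro mult_left_mono) (auto simp: u_def Y_def)
  finally have "Y * Y \<le> (s\<^sup>2 * X) * Y" by (simp add: power2_eq_square mult_ac)
  then have "Y \<le> s\<^sup>2 * X"
    using \<open>Y \<ge> 0\<close> \<open>X \<ge> 0\<close> by (cases "Y = 0") auto
  then show ?thesis by (simp add: X_def Y_def y_def)
qed

text \<open>The left side is the quadratic form of the identity minus T T* / s^2. It is nonnegative
  by \<open>transpose_bound\<close>, and a Gram factorisation of its matrix \<open>h\<close> writes
  it as a sum of squares of linear forms.\<close>

lemma contraction_defect_decomposition:
  fixes T :: "'b \<Rightarrow> 'a \<Rightarrow> complex"
  assumes "finite B" "s > 0"
    and bd: "\<And>f. (\<Sum>b\<in>B. (cmod (\<Sum>a\<in>A. T b a * f a))\<^sup>2) \<le> s\<^sup>2 * (\<Sum>a\<in>A. (cmod (f a))\<^sup>2)"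
  obtains v where "\<And>x. (\<Sum>b\<in>B. (cmod (x b))\<^sup>2) - (\<Sum>a\<in>A. (cmod (\<Sum>b\<in>B. T b a * x b))\<^sup>2) / s\<^sup>2
      = (\<Sum>i\<in>B. (cmod (\<Sum>b\<in>B. v i b * x b))\<^sup>2)"
proof -
  define h where "h b c = (if b = c then 1 else 0) - (\<Sum>a\<in>A. T b a * cnj (T c a)) / of_real (s\<^sup>2)" for b c
  have form: "(\<Sum>b\<in>B. \<Sum>c\<in>B. x b * cnj (x c) * h b c) =
      of_real ((\<Sum>b\<in>B. (cmod (x b))\<^sup>2) - (\<Sum>a\<in>A. (cmod (\<Sum>b\<in>B. T b a * x b))\<^sup>2) / s\<^sup>2)" for x
  proof -
    have 1: "(\<Sum>b\<in>B. \<Sum>c\<in>B. x b * cnj (x c) * (if b = c then 1 else 0)) = of_real (\<Sum>b\<in>B. (cmod (x b))\<^sup>2)"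
      using \<open>finite B\<close>
      by (simp add: if_distrib complex_norm_square cong: if_cong flip: of_real_power)
    have "of_real (\<Sum>a\<in>A. (cmod (\<Sum>b\<in>B. T b a * x b))\<^sup>2) =
        (\<Sum>a\<in>A. \<Sum>b\<in>B. \<Sum>c\<in>B. (T b a * x b) * cnj (T c a * x c))"
      by (simp only: of_real_sum complex_norm_square cnj_sum sum_product)
    also have "\<dots> = (\<Sum>b\<in>B. \<Sum>c\<in>B. \<Sum>a\<in>A. (T b a * x b) * cnj (T c a * x c))"
      by (subst sum.swap, subst (2) sum.swap) simp
    also have "\<dots> = (\<Sum>b\<in>B. \<Sum>c\<in>B. x b * cnj (x c) * (\<Sum>a\<in>A. T b a * cnj (T c a)))"
      by (simp add: sum_distrib_left mult_ac)
    finally have 2: "of_real (\<Sum>a\<in>A. (cmod (\<Sum>b\<in>B. T b a * x b))\<^sup>2) / of_real (s\<^sup>2) =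
        (\<Sum>b\<in>B. \<Sum>c\<in>B. x b * cnj (x c) * ((\<Sum>a\<in>A. T b a * cnj (T c a)) / of_real (s\<^sup>2)))"
      by (simp only: sum_divide_distrib[of _ B] times_divide_eq_right)
    show ?thesis
      unfolding h_def right_diff_distrib sum_subtractf 1 of_real_diff of_real_divide
      by (subst 2[symmetric]) simp
  qed
  have "\<exists>v. \<forall>b\<in>B. \<forall>c\<in>B. h b c = (\<Sum>i\<in>B. v i b * cnj (v i c))"
  proof (rule positive_semidefinite_decomposition[OF \<open>finite B\<close>])
    show "h c b = cnj (h b c)" for b c
      by (simp add: h_def cnj_sum mult.commute)
    show "0 \<le> Re (\<Sum>b\<in>B. \<Sum>c\<in>B. x b * cnj (x c) * h b c)" for x
      using transpose_bound[OF bd, of x] \<open>s > 0\<close>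
      unfolding form by (simp add: field_simps)
  qed
  then obtain v where v: "\<And>b c. b \<in> B \<Longrightarrow> c \<in> B \<Longrightarrow> h b c = (\<Sum>i\<in>B. v i b * cnj (v i c))"
    by blast
  show thesis
  proof
    fix x
    have "of_real (\<Sum>i\<in>B. (cmod (\<Sum>b\<in>B. v i b * x b))\<^sup>2) =
        (\<Sum>i\<in>B. \<Sum>b\<in>B. \<Sum>c\<in>B. (v i b * x b) * cnj (v i c * x c))"
      by (simp only: of_real_sum complex_norm_square cnj_sum sum_product)
    also have "\<dots> = (\<Sum>b\<in>B. \<Sum>c\<in>B. \<Sum>i\<in>B. (v i b * x b) * cnj (v i c * x c))"
      by (subst sum.swap, subst (2) sum.swap) simp
    also have "\<dots> = (\<Sum>b\<in>B. \<Sum>c\<in>B. x b * cnj (x c) * h b c)"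
      by (intro sum.cong refl) (simp add: v sum_distrib_left mult_ac)
    finally show "(\<Sum>b\<in>B. (cmod (x b))\<^sup>2) - (\<Sum>a\<in>A. (cmod (\<Sum>b\<in>B. T b a * x b))\<^sup>2) / s\<^sup>2
      = (\<Sum>i\<in>B. (cmod (\<Sum>b\<in>B. v i b * x b))\<^sup>2)"
      unfolding form of_real_eq_iff by simp
  qed
qed

section \<open>Moments of the simplex and averages over the torus\<close>

text \<open>Integration by parts trades a power of \<open>x\<close> for a power of
  \<open>s - x\<close>, which is why \<open>b\<close> must vary in the induction on
  \<open>a\<close>. The boundary term \<open>?F\<close> vanishes at both ends.\<close>

lemma has_integral_beta_nat:
  fixes s :: real
  assumes "s \<ge> 0"
  shows "((\<lambda>x. x ^ a * (s - x) ^ b) has_integral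
           (s ^ Suc (a + b) * fact a * fact b / fact (Suc (a + b)))) {0..s}"
proof (induction a arbitrary: b)
  case 0
  have "((\<lambda>x. (s - x) ^ b) has_integral (- ((s - s) ^ Suc b / Suc b) - (- ((s - 0) ^ Suc b / Suc b)))) {0..s}"
    by (rule fundamental_theorem_of_calculus[OF assms])
       (auto simp flip: has_real_derivative_iff_has_vector_derivative
             intro!: derivative_eq_intros simp: field_simps simp del: of_nat_Suc power_Suc)
  moreover have "s ^ Suc b / Suc b = s ^ Suc (0 + b) * fact 0 * fact b / fact (Suc (0 + b))"
    by (simp add: divide_simps)
  ultimately show ?case by simp
next
  case (Suc a)
  let ?F = "\<lambda>x. - (x ^ Suc a * (s - x) ^ Suc b / Suc b)"
  let ?c = "real (Suc a) / real (Suc b)"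
  have "((\<lambda>x. x ^ Suc a * (s - x) ^ b - ?c * (x ^ a * (s - x) ^ Suc b)) has_integral (?F s - ?F 0)) {0..s}"
  proof (rule fundamental_theorem_of_calculus[OF assms])
    fix x :: real
    have "(?F has_real_derivative
        - ((real (Suc a) * x ^ a * (s - x) ^ Suc b - x ^ Suc a * (real (Suc b) * (s - x) ^ b)) / real (Suc b)))
        (at x within {0..s})"
      by (auto intro!: derivative_eq_intros simp del: of_nat_Suc power_Suc)
    also have "- ((real (Suc a) * x ^ a * (s - x) ^ Suc b - x ^ Suc a * (real (Suc b) * (s - x) ^ b)) / real (Suc b))
        = x ^ Suc a * (s - x) ^ b - ?c * (x ^ a * (s - x) ^ Suc b)"
      by (simp add: field_simps del: of_nat_Suc power_Suc)
    finally show "(?F has_vector_derivative x ^ Suc a * (s - x) ^ b - ?c * (x ^ a * (s - x) ^ Suc b))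
        (at x within {0..s})"
      by (simp only: has_real_derivative_iff_has_vector_derivative)
  qed
  from has_integral_add[OF this has_integral_mult_right[OF Suc.IH[of "Suc b"], of ?c]]
  have "((\<lambda>x. x ^ Suc a * (s - x) ^ b) has_integral
      ?c * (s ^ Suc (a + Suc b) * fact a * fact (Suc b) / fact (Suc (a + Suc b)))) {0..s}"
    by simp
  also have "?c * (s ^ Suc (a + Suc b) * fact a * fact (Suc b) / fact (Suc (a + Suc b))) =
      s ^ Suc (Suc a + b) * fact (Suc a) * fact b / fact (Suc (Suc a + b))"
    by (simp add: divide_simps del: of_nat_Suc fact_Suc) (simp add: fact_Suc[of a] fact_Suc[of b] algebra_simps)
  finally show ?case .
qed

text \<open>Dirichlet's integral by slicing: fixing one coordinate \<open>y\<close> leaves a simplex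
  of size \<open>s - y\<close>, whose integral is a constant times a power of \<open>s - y\<close>.
  What remains is a Beta integral in \<open>y\<close>.\<close>

lemma nn_integral_simplex_monomial:
  fixes \<alpha> :: "'i \<Rightarrow> nat"
  assumes "finite I" "s \<ge> 0"
  shows "(\<integral>\<^sup>+t. ennreal (if (\<forall>i\<in>I. 0 \<le> t i) \<and> (\<Sum>i\<in>I. t i) \<le> s then \<Prod>i\<in>I. t i ^ \<alpha> i else 0)
            \<partial>(PiM I (\<lambda>_. lborel))) =
         ennreal (s ^ ((\<Sum>i\<in>I. \<alpha> i) + card I) * (\<Prod>i\<in>I. fact (\<alpha> i)) / fact ((\<Sum>i\<in>I. \<alpha> i) + card I))"
  using assms
proof (induction I arbitrary: s rule: finite_induct)
  case empty
  interpret product_sigma_finite "\<lambda>_::'i. lborel :: real measure" by standard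
  from empty show ?case by (simp add: PiM_empty)
next
  case (insert i I)
  interpret product_sigma_finite "\<lambda>_::'i. lborel :: real measure" by standard
  define f where "f I s t = (if (\<forall>i\<in>I. 0 \<le> t i) \<and> (\<Sum>i\<in>I. t i) \<le> s then \<Prod>i\<in>I. t i ^ \<alpha> i else 0)"
    for I and s :: real and t :: "'i \<Rightarrow> real"
  define n where "n = (\<Sum>i\<in>I. \<alpha> i) + card I"
  define C where "C = (\<Prod>i\<in>I. fact (\<alpha> i)) / (fact n :: real)"
  have [measurable]: "f J r \<in> borel_measurable (PiM J (\<lambda>_. lborel))" if "finite J" for J r
    using that unfolding f_def by measurable
  \<comment> \<open>The slice is empty unless \<open>y\<close> lies in \<open>{0..s}\<close>,
    because the other coordinates are nonnegative.\<close>
  have upd: "f (insert i I) s (t(i := y)) = (if y \<in> {0..s} then y ^ \<alpha> i * f I (s - y) t else 0)" for t y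
  proof -
    have *: "(\<Sum>j\<in>I. (t(i := y)) j) = (\<Sum>j\<in>I. t j)" "(\<Prod>j\<in>I. (t(i := y)) j ^ \<alpha> j) = (\<Prod>j\<in>I. t j ^ \<alpha> j)"
      "(\<forall>j\<in>I. 0 \<le> (t(i := y)) j) \<longleftrightarrow> (\<forall>j\<in>I. 0 \<le> t j)"
      using insert.hyps by (auto intro!: sum.cong prod.cong)
    have "y \<le> s" if "\<forall>j\<in>I. 0 \<le> t j" "y + (\<Sum>j\<in>I. t j) \<le> s"
      using sum_nonneg[of I t] that by force
    then show ?thesis
      using insert.hyps unfolding f_def by (auto simp: * fun_upd_same simp del: fun_upd_apply)
  qed
  have "(\<integral>\<^sup>+t. ennreal (f (insert i I) s t) \<partial>(PiM (insert i I) (\<lambda>_. lborel))) =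
      (\<integral>\<^sup>+y. \<integral>\<^sup>+t. ennreal (f (insert i I) s (t(i := y))) \<partial>(PiM I (\<lambda>_. lborel)) \<partial>lborel)"
    using insert.hyps by (subst product_nn_integral_insert_rev) auto
  also have "\<dots> = (\<integral>\<^sup>+y. ennreal (y ^ \<alpha> i * (s - y) ^ n * C) * indicator {0..s} y \<partial>lborel)"
  proof (rule nn_integral_cong)
    fix y :: real
    show "(\<integral>\<^sup>+t. ennreal (f (insert i I) s (t(i := y))) \<partial>(PiM I (\<lambda>_. lborel))) =
        ennreal (y ^ \<alpha> i * (s - y) ^ n * C) * indicator {0..s} y"
    proof (cases "y \<in> {0..s}")
      case True
      then have "(\<integral>\<^sup>+t. ennreal (f (insert i I) s (t(i := y))) \<partial>(PiM I (\<lambda>_. lborel))) =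
          (\<integral>\<^sup>+t. ennreal (y ^ \<alpha> i) * ennreal (f I (s - y) t) \<partial>(PiM I (\<lambda>_. lborel)))"
        by (simp add: upd ennreal_mult')
      also have "\<dots> = ennreal (y ^ \<alpha> i) * (\<integral>\<^sup>+t. ennreal (f I (s - y) t) \<partial>(PiM I (\<lambda>_. lborel)))"
        using insert.hyps by (intro nn_integral_cmult) auto
      also have "(\<integral>\<^sup>+t. ennreal (f I (s - y) t) \<partial>(PiM I (\<lambda>_. lborel))) = ennreal ((s - y) ^ n * C)"
        using insert.IH[of "s - y"] True by (simp add: f_def n_def C_def)
      also have "ennreal (y ^ \<alpha> i) * \<dots> = ennreal (y ^ \<alpha> i * (s - y) ^ n * C)"
        using True by (simp add: mult.assoc flip: ennreal_mult')
      finally show ?thesis using True by (simp del: fun_upd_apply)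
    qed (simp add: upd del: atLeastAtMost_iff)
  qed
  also have "\<dots> = ennreal (s ^ Suc (\<alpha> i + n) * fact (\<alpha> i) * fact n / fact (Suc (\<alpha> i + n)) * C)"
    by (rule nn_integral_has_integral_lebesgue'[OF _ has_integral_mult_left[OF has_integral_beta_nat]])
       (use insert.prems in \<open>auto simp: C_def intro!: mult_nonneg_nonneg divide_nonneg_nonneg prod_nonneg\<close>)
  also have "s ^ Suc (\<alpha> i + n) * fact (\<alpha> i) * fact n / fact (Suc (\<alpha> i + n)) * C =
      s ^ ((\<Sum>i\<in>insert i I. \<alpha> i) + card (insert i I)) * (\<Prod>i\<in>insert i I. fact (\<alpha> i)) /
        fact ((\<Sum>i\<in>insert i I. \<alpha> i) + card (insert i I))"
    using insert.hyps by (simp add: C_def n_def add.assoc del: fact_Suc power_Suc)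
  finally show ?case by (simp only: f_def)
qed

text \<open>The multinomial theorem divided by \<open>k!\<close>, by induction from the binomial
  theorem. Requiring zeros outside \<open>I\<close> makes each exponent pattern occur once.\<close>

lemma multinomial_over_factorials:
  fixes x :: "'i \<Rightarrow> real"
  assumes "finite I"
  shows "finite {\<alpha>. (\<forall>i. i \<notin> I \<longrightarrow> \<alpha> i = (0::nat)) \<and> (\<Sum>i\<in>I. \<alpha> i) = k} \<and>
    (\<Sum>\<alpha> | (\<forall>i. i \<notin> I \<longrightarrow> \<alpha> i = (0::nat)) \<and> (\<Sum>i\<in>I. \<alpha> i) = k. \<Prod>i\<in>I. x i ^ \<alpha> i / fact (\<alpha> i)) =
      (\<Sum>i\<in>I. x i) ^ k / fact k"
  using assms
proof (induction I arbitrary: k rule: finite_induct)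
  case empty
  have "{\<alpha>. (\<forall>i. \<alpha> i = 0) \<and> 0 = k} = (if k = 0 then {\<lambda>_::'i. 0::nat} else {})"
    by auto
  then show ?case by (simp add: power_0_left)
next
  case (insert c I)
  define P where "P I k = {\<alpha>. (\<forall>i. i \<notin> I \<longrightarrow> \<alpha> i = (0::nat)) \<and> (\<Sum>i\<in>I. \<alpha> i) = k}" for I :: "'i set" and k
  define m where "m I \<alpha> = (\<Prod>i\<in>I. x i ^ \<alpha> i / fact (\<alpha> i))" for I and \<alpha> :: "'i \<Rightarrow> nat"
  have IH: "finite (P I k)" "sum (m I) (P I k) = (\<Sum>i\<in>I. x i) ^ k / fact k" for k
    using insert.IH[of k] by (simp_all add: P_def m_def[abs_def])
  have sum_upd: "(\<Sum>i\<in>I. (\<alpha>(c := j)) i) = (\<Sum>i\<in>I. \<alpha> i)" for \<alpha> and j :: nat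
    using insert.hyps by (intro sum.cong) auto
  have prod_upd: "m (insert c I) (\<alpha>(c := j)) = x c ^ j / fact j * m I \<alpha>" for \<alpha> j
  proof -
    have "m I (\<alpha>(c := j)) = m I \<alpha>"
      unfolding m_def using insert.hyps by (intro prod.cong) auto
    then show ?thesis
      using insert.hyps by (simp add: m_def)
  qed
  \<comment> \<open>A multi-index on \<open>insert c I\<close> is its exponent \<open>j\<close> at
    \<open>c\<close> together with a multi-index of degree \<open>k - j\<close> on
    \<open>I\<close>.\<close>
  have bij: "bij_betw (\<lambda>(j, \<alpha>). \<alpha>(c := j)) (SIGMA j:{..k}. P I (k - j)) (P (insert c I) k)"
    by (rule bij_betw_byWitness[where f' = "\<lambda>\<alpha>. (\<alpha> c, \<alpha>(c := 0))"])
       (use insert.hyps in \<open>auto simp: P_def sum_upd fun_eq_iff simp del: fun_upd_apply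
          intro!: sum.cong split: if_splits, auto\<close>)
  have fin: "finite (P (insert c I) k)"
    using bij_betw_finite[OF bij] IH(1) by auto
  have "sum (m (insert c I)) (P (insert c I) k) =
      (\<Sum>(j, \<alpha>)\<in>(SIGMA j:{..k}. P I (k - j)). x c ^ j / fact j * m I \<alpha>)"
    by (subst sum.reindex_bij_betw[OF bij, symmetric], intro sum.cong) (auto simp: prod_upd)
  also have "\<dots> = (\<Sum>j\<le>k. x c ^ j / fact j * ((\<Sum>i\<in>I. x i) ^ (k - j) / fact (k - j)))"
    using IH by (subst sum.Sigma[symmetric]) (simp_all only: finite_atMost ball_triv simp_thms flip: sum_distrib_left)
  also have "\<dots> = (\<Sum>j\<le>k. of_nat (k choose j) * x c ^ j * (\<Sum>i\<in>I. x i) ^ (k - j)) / fact k"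
    by (auto simp: sum_divide_distrib binomial_fact intro!: sum.cong)
  also have "\<dots> = (\<Sum>i\<in>insert c I. x i) ^ k / fact k"
    using insert.hyps by (simp add: binomial_ring)
  finally show ?case
    using fin by (simp add: P_def m_def[abs_def])
qed

text \<open>The terms are the powers of one \<open>M\<close>-th root of unity \<open>w\<close>, so
  the geometric sum vanishes unless \<open>w = 1\<close>. Since both exponents are below
  \<open>M\<close>, that happens only for equal exponents.\<close>

lemma sum_roots_unity_orthogonal:
  assumes "a < M" "b < M"
  shows "(\<Sum>l<M. cis (2 * pi * real l / real M) ^ a * cnj (cis (2 * pi * real l / real M) ^ b)) =
    (if a = b then of_nat M else 0)"
proof -
  define z where "z k = cis (2 * pi * real k / real M)" for k
  have M: "M > 0" using assms by simp
  define w where "w = z a * cnj (z b)"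
  have "z l ^ a * cnj (z l ^ b) = w ^ l" for l
    by (simp add: w_def z_def Complex.DeMoivre cis_cnj cis_mult power_mult_distrib)
       (simp add: algebra_simps)
  then have sum: "(\<Sum>l<M. z l ^ a * cnj (z l ^ b)) = (\<Sum>l<M. w ^ l)" by simp
  have one: "z k ^ M = 1" for k
    using M cis_multiple_2pi[of "real k"] by (simp add: z_def Complex.DeMoivre)
  have "w ^ M = 1"
    by (simp add: w_def power_mult_distrib one flip: complex_cnj_power)
  moreover have "w = 1 \<longleftrightarrow> a = b"
  proof
    assume "w = 1"
    have "z b * cnj (z b) = 1"
      by (simp add: z_def cis_cnj cis_mult)
    with \<open>w = 1\<close> have "z a = z b"
      unfolding w_def by (metis mult.commute mult.left_commute mult_1)
    then show "a = b"
      using bij_betw_imp_inj_on[OF Complex.bij_betw_roots_unity[OF M]] assms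
      by (auto simp: inj_on_def z_def)
  next
    assume "a = b" then show "w = 1"
      by (simp add: w_def z_def cis_cnj cis_mult)
  qed
  ultimately show ?thesis
    using sum by (auto simp: z_def geometric_sum)
qed

section \<open>Multiplication by a polynomial and the truncated kernels\<close>

definition multidegree :: "('n::finite \<Rightarrow> nat) \<Rightarrow> nat" where
  "multidegree \<alpha> = (\<Sum>j\<in>UNIV. \<alpha> j)"

definition monomial :: "('n::finite \<Rightarrow> nat) \<Rightarrow> complex ^ 'n \<Rightarrow> complex" where
  "monomial \<alpha> z = (\<Prod>j\<in>UNIV. (z $ j) ^ \<alpha> j)"

text \<open>Dirichlet's value for the integral of t^\<alpha> over the simplex where the t_j are
  nonnegative with sum at most 1. With t_j = |z_j|^2 it serves as the squared norm of
  \<open>monomial \<alpha>\<close>.\<close>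

definition simplex_moment :: "('n::finite \<Rightarrow> nat) \<Rightarrow> real" where
  "simplex_moment \<alpha> = (\<Prod>j\<in>UNIV. fact (\<alpha> j)) / fact (multidegree \<alpha> + CARD('n))"

lemma simplex_moment_pos: "simplex_moment \<alpha> > 0"
  by (auto simp: simplex_moment_def intro!: divide_pos_pos prod_pos)

lemma simplex_moment_nonneg: "simplex_moment \<alpha> \<ge> 0"
  using simplex_moment_pos[of \<alpha>] by simp

lemma monomial_add: "monomial (\<lambda>j. \<alpha> j + \<beta> j) z = monomial \<alpha> z * monomial \<beta> z"
  by (simp add: monomial_def power_add prod.distrib)

lemma norm_vec_power2: "(norm (z :: complex ^ 'n))\<^sup>2 = (\<Sum>j\<in>UNIV. (cmod (z $ j))\<^sup>2)"
  by (simp add: norm_vec_def L2_set_def sum_nonneg)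

lemma finite_multidegree_eq: "finite {\<alpha> :: 'n::finite \<Rightarrow> nat. multidegree \<alpha> = k}"
  using multinomial_over_factorials[of "UNIV :: 'n set" k] by (simp add: multidegree_def)

lemma finite_multidegree_less: "finite {\<alpha> :: 'n::finite \<Rightarrow> nat. multidegree \<alpha> < k}"
proof -
  have "{\<alpha> :: 'n \<Rightarrow> nat. multidegree \<alpha> < k} = (\<Union>i<k. {\<alpha>. multidegree \<alpha> = i})" by auto
  moreover have "finite \<dots>" by (intro finite_UN_I finite_lessThan finite_multidegree_eq)
  ultimately show ?thesis by simp
qed

text \<open>A finite grid of roots of unity replaces the integral over the torus. Since all
  exponents are below \<open>M\<close>, distinct monomials of \<open>A\<close> are exactly
  orthogonal on the grid.\<close>

lemma parseval_torus:
  fixes A :: "('n::finite \<Rightarrow> nat) set" and r :: "'n \<Rightarrow> real"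
  assumes "\<And>\<alpha> j. \<alpha> \<in> A \<Longrightarrow> \<alpha> j < M"
  shows "(\<Sum>\<theta>\<in>PiE UNIV (\<lambda>_. {..<M}).
      (cmod (\<Sum>\<alpha>\<in>A. c \<alpha> * monomial \<alpha> (\<chi> j. of_real (r j) * cis (2 * pi * real (\<theta> j) / real M))))\<^sup>2) =
    real M ^ CARD('n) * (\<Sum>\<alpha>\<in>A. (cmod (c \<alpha>))\<^sup>2 * (\<Prod>j\<in>UNIV. ((r j)\<^sup>2) ^ \<alpha> j))"
proof (cases "finite A")
  case False then show ?thesis by simp
next
  case True
  define \<Theta> where "\<Theta> = PiE (UNIV :: 'n set) (\<lambda>_. {..<M})"
  define w where "w l = cis (2 * pi * real l / real M)" for l
  define R where "R \<alpha> = (\<Prod>j\<in>UNIV. complex_of_real (r j) ^ \<alpha> j)" for \<alpha>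
  define W where "W \<theta> \<alpha> = (\<Prod>j\<in>UNIV. w (\<theta> j) ^ \<alpha> j)" for \<theta> :: "'n \<Rightarrow> nat" and \<alpha> :: "'n \<Rightarrow> nat"
  have mono: "monomial \<alpha> (\<chi> j. of_real (r j) * w (\<theta> j)) = R \<alpha> * W \<theta> \<alpha>" for \<alpha> \<theta>
    by (simp add: monomial_def R_def W_def power_mult_distrib prod.distrib)
  have orth: "(\<Sum>\<theta>\<in>\<Theta>. W \<theta> \<alpha> * cnj (W \<theta> \<beta>)) = (if \<alpha> = \<beta> then of_nat M ^ CARD('n) else 0)"
    if "\<alpha> \<in> A" "\<beta> \<in> A" for \<alpha> \<beta>
  proof -
    have "(\<Sum>\<theta>\<in>\<Theta>. W \<theta> \<alpha> * cnj (W \<theta> \<beta>)) = (\<Sum>\<theta>\<in>\<Theta>. \<Prod>j\<in>UNIV. w (\<theta> j) ^ \<alpha> j * cnj (w (\<theta> j) ^ \<beta> j))"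
      by (simp add: W_def prod.distrib)
    also have "\<dots> = (\<Prod>j\<in>UNIV. \<Sum>l<M. w l ^ \<alpha> j * cnj (w l ^ \<beta> j))"
      unfolding \<Theta>_def by (subst prod_sum_PiE) auto
    also have "\<dots> = (\<Prod>j\<in>UNIV. if \<alpha> j = \<beta> j then of_nat M else 0)"
      using assms that by (intro prod.cong refl) (simp add: w_def sum_roots_unity_orthogonal del: complex_cnj_power)
    also have "\<dots> = (if \<alpha> = \<beta> then of_nat M ^ CARD('n) else 0)"
      by (auto simp: fun_eq_iff intro!: prod_zero)
    finally show ?thesis .
  qed
  have "complex_of_real (\<Sum>\<theta>\<in>\<Theta>. (cmod (\<Sum>\<alpha>\<in>A. c \<alpha> * (R \<alpha> * W \<theta> \<alpha>)))\<^sup>2) =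
      (\<Sum>\<theta>\<in>\<Theta>. \<Sum>\<alpha>\<in>A. \<Sum>\<beta>\<in>A. (c \<alpha> * (R \<alpha> * W \<theta> \<alpha>)) * cnj (c \<beta> * (R \<beta> * W \<theta> \<beta>)))"
    by (simp only: of_real_sum complex_norm_square cnj_sum sum_product)
  also have "\<dots> = (\<Sum>\<alpha>\<in>A. \<Sum>\<beta>\<in>A. \<Sum>\<theta>\<in>\<Theta>. (c \<alpha> * (R \<alpha> * W \<theta> \<alpha>)) * cnj (c \<beta> * (R \<beta> * W \<theta> \<beta>)))"
    by (subst sum.swap, subst (2) sum.swap) simp
  also have "\<dots> = (\<Sum>\<alpha>\<in>A. \<Sum>\<beta>\<in>A. c \<alpha> * R \<alpha> * cnj (c \<beta> * R \<beta>) * (\<Sum>\<theta>\<in>\<Theta>. W \<theta> \<alpha> * cnj (W \<theta> \<beta>)))"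
    by (simp add: sum_distrib_left mult_ac)
  also have "\<dots> = (\<Sum>\<alpha>\<in>A. \<Sum>\<beta>\<in>A. if \<alpha> = \<beta> then c \<alpha> * R \<alpha> * cnj (c \<beta> * R \<beta>) * of_nat M ^ CARD('n) else 0)"
    by (intro sum.cong refl) (simp add: orth)
  also have "\<dots> = (\<Sum>\<alpha>\<in>A. c \<alpha> * R \<alpha> * cnj (c \<alpha> * R \<alpha>) * of_nat M ^ CARD('n))"
    using True by simp
  also have "\<dots> = (\<Sum>\<alpha>\<in>A. of_real ((cmod (c \<alpha> * R \<alpha>))\<^sup>2) * of_nat M ^ CARD('n))"
    by (simp only: complex_norm_square)
  also have "\<dots> = of_real (real M ^ CARD('n) * (\<Sum>\<alpha>\<in>A. (cmod (c \<alpha>))\<^sup>2 * (cmod (R \<alpha>))\<^sup>2))"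
    by (simp add: sum_distrib_left norm_mult power_mult_distrib mult_ac)
  finally have "(\<Sum>\<theta>\<in>\<Theta>. (cmod (\<Sum>\<alpha>\<in>A. c \<alpha> * (R \<alpha> * W \<theta> \<alpha>)))\<^sup>2) =
      real M ^ CARD('n) * (\<Sum>\<alpha>\<in>A. (cmod (c \<alpha>))\<^sup>2 * (cmod (R \<alpha>))\<^sup>2)"
    by (simp only: of_real_eq_iff)
  moreover have "(cmod (R \<alpha>))\<^sup>2 = (\<Prod>j\<in>UNIV. ((r j)\<^sup>2) ^ \<alpha> j)" for \<alpha>
  proof -
    have "(\<bar>x\<bar> ^ a)\<^sup>2 = (x\<^sup>2) ^ a" for x :: real and a
      by (metis power2_abs power_mult mult.commute)
    then show ?thesis
      by (simp add: R_def prod_norm[symmetric] norm_power prod_power_distrib)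
  qed
  ultimately show ?thesis
    by (simp add: \<Theta>_def mono[unfolded w_def])
qed

text \<open>The pointwise inequality is integrated over the simplex. Nonnegative coefficients allow
  extended nonnegative integrals, which need no integrability argument.\<close>

lemma simplex_moment_mono:
  fixes A B :: "('n::finite \<Rightarrow> nat) set"
  assumes nonneg: "\<And>\<alpha>. \<alpha> \<in> A \<Longrightarrow> 0 \<le> a \<alpha>" "\<And>\<beta>. \<beta> \<in> B \<Longrightarrow> 0 \<le> b \<beta>"
    and le: "\<And>t. (\<And>j. 0 \<le> t j) \<Longrightarrow> (\<Sum>j\<in>UNIV. t j) \<le> 1 \<Longrightarrow>
      (\<Sum>\<beta>\<in>B. b \<beta> * (\<Prod>j\<in>UNIV. t j ^ \<beta> j)) \<le> (\<Sum>\<alpha>\<in>A. a \<alpha> * (\<Prod>j\<in>UNIV. t j ^ \<alpha> j))"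
  shows "(\<Sum>\<beta>\<in>B. b \<beta> * simplex_moment \<beta>) \<le> (\<Sum>\<alpha>\<in>A. a \<alpha> * simplex_moment \<alpha>)"
proof -
  define M where "M = PiM (UNIV :: 'n set) (\<lambda>_. lborel :: real measure)"
  define F where "F \<alpha> t = (if (\<forall>j. 0 \<le> t j) \<and> (\<Sum>j\<in>UNIV. t j) \<le> (1::real)
      then \<Prod>j\<in>UNIV. t j ^ \<alpha> j else 0)" for \<alpha> :: "'n \<Rightarrow> nat" and t
  have [measurable]: "F \<alpha> \<in> borel_measurable M" for \<alpha>
    unfolding F_def M_def by measurable
  have F_nonneg: "0 \<le> F \<alpha> t" for \<alpha> t
    by (auto simp: F_def intro!: prod_nonneg)
  have mom: "(\<integral>\<^sup>+t. ennreal (F \<alpha> t) \<partial>M) = ennreal (simplex_moment \<alpha>)" for \<alpha>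
    using nn_integral_simplex_monomial[of "UNIV :: 'n set" 1 \<alpha>]
    by (simp add: F_def M_def simplex_moment_def multidegree_def)
  have int: "(\<integral>\<^sup>+t. ennreal (\<Sum>\<alpha>\<in>C. c \<alpha> * F \<alpha> t) \<partial>M) = ennreal (\<Sum>\<alpha>\<in>C. c \<alpha> * simplex_moment \<alpha>)"
    if "\<And>\<alpha>. \<alpha> \<in> C \<Longrightarrow> 0 \<le> c \<alpha>" for C c
  proof -
    have "(\<integral>\<^sup>+t. ennreal (\<Sum>\<alpha>\<in>C. c \<alpha> * F \<alpha> t) \<partial>M) = (\<integral>\<^sup>+t. (\<Sum>\<alpha>\<in>C. ennreal (c \<alpha>) * ennreal (F \<alpha> t)) \<partial>M)"
      using that F_nonneg
      by (intro nn_integral_cong, subst sum_ennreal[symmetric]) (auto simp: ennreal_mult)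
    also have "\<dots> = (\<Sum>\<alpha>\<in>C. ennreal (c \<alpha>) * ennreal (simplex_moment \<alpha>))"
      by (simp add: nn_integral_sum nn_integral_cmult mom)
    also have "\<dots> = ennreal (\<Sum>\<alpha>\<in>C. c \<alpha> * simplex_moment \<alpha>)"
      using that simplex_moment_nonneg
      by (subst sum_ennreal[symmetric]) (auto simp: ennreal_mult intro!: mult_nonneg_nonneg)
    finally show ?thesis .
  qed
  have "(\<Sum>\<beta>\<in>B. b \<beta> * F \<beta> t) \<le> (\<Sum>\<alpha>\<in>A. a \<alpha> * F \<alpha> t)" for t
  proof (cases "(\<forall>j. 0 \<le> t j) \<and> (\<Sum>j\<in>UNIV. t j) \<le> 1")
    case True
    then show ?thesis using le[of t] by (simp add: F_def)
  next
    case False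
    then have "F \<alpha> t = 0" for \<alpha> unfolding F_def by (rule if_not_P)
    then show ?thesis by simp
  qed
  then have "ennreal (\<Sum>\<beta>\<in>B. b \<beta> * simplex_moment \<beta>) \<le> ennreal (\<Sum>\<alpha>\<in>A. a \<alpha> * simplex_moment \<alpha>)"
    using nonneg by (subst (1 2) int[symmetric]) (auto intro!: nn_integral_mono ennreal_leI)
  then show ?thesis
    using nonneg
    by (subst (asm) ennreal_le_iff) (auto intro!: sum_nonneg mult_nonneg_nonneg simplex_moment_nonneg)
qed

text \<open>The reproducing kernel on the diagonal, computed by grouping monomials by degree and
  applying the multinomial theorem to the numbers |z_j|^2.\<close>

lemma sum_monomial_over_moment:
  fixes z :: "complex ^ 'n"
  shows "(\<Sum>\<alpha> | multidegree \<alpha> < L. (cmod (monomial \<alpha> z))\<^sup>2 / simplex_moment \<alpha>) =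
    (\<Sum>k<L. fact (k + CARD('n)) / fact k * ((norm z)\<^sup>2) ^ k)"
proof -
  have "(\<Sum>\<alpha> | multidegree \<alpha> < L. (cmod (monomial \<alpha> z))\<^sup>2 / simplex_moment \<alpha>) =
    (\<Sum>k<L. \<Sum>\<alpha> | multidegree \<alpha> = k. (cmod (monomial \<alpha> z))\<^sup>2 / simplex_moment \<alpha>)"
    by (subst sum.group[OF finite_multidegree_less finite_lessThan, of multidegree L L, symmetric])
       (auto intro!: sum.cong)
  also have "\<dots> = (\<Sum>k<L. fact (k + CARD('n)) *
      (\<Sum>\<alpha> | multidegree \<alpha> = k. \<Prod>j\<in>UNIV. ((cmod (z $ j))\<^sup>2) ^ \<alpha> j / fact (\<alpha> j)))"
    unfolding sum_distrib_left
    by (intro sum.cong refl)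
       (auto simp: simplex_moment_def monomial_def prod_norm[symmetric] norm_power prod_power_distrib
          prod_dividef power_mult[symmetric] mult.commute)
  also have "\<dots> = (\<Sum>k<L. fact (k + CARD('n)) / fact k * ((norm z)\<^sup>2) ^ k)"
    using multinomial_over_factorials[of "UNIV :: 'n set" _ "\<lambda>j. (cmod (z $ j))\<^sup>2"]
    by (simp add: multidegree_def norm_vec_power2)
  finally show ?thesis .
qed

text \<open>\<open>C\<close> is the matrix of multiplication by \<open>q\<close> on monomial
  coefficients. The torus |z_j|^2 = t_j lies in the closed ball when the t_j have sum at most 1, so
  |q f|^2 is at most s^2 |f|^2 on it; Parseval turns this into an inequality in \<open>t\<close>
  that \<open>simplex_moment_mono\<close> integrates.\<close>

lemma multiplication_bound:
  fixes q :: "complex ^ 'n \<Rightarrow> complex"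
  assumes "finite A0" and q: "\<And>z. q z = (\<Sum>\<delta>\<in>A0. c \<delta> * monomial \<delta> z)"
    and deg: "\<And>\<delta>. \<delta> \<in> A0 \<Longrightarrow> multidegree \<delta> \<le> d"
    and bd: "\<And>z. norm z \<le> 1 \<Longrightarrow> cmod (q z) \<le> s"
  obtains C where
    "\<And>\<alpha> z. multidegree \<alpha> < L \<Longrightarrow>
      (\<Sum>\<gamma> | multidegree \<gamma> < L + d. C \<gamma> \<alpha> * monomial \<gamma> z) = q z * monomial \<alpha> z"
    "\<And>f. (\<Sum>\<gamma> | multidegree \<gamma> < L + d.
        (cmod (\<Sum>\<alpha> | multidegree \<alpha> < L. C \<gamma> \<alpha> * f \<alpha>))\<^sup>2 * simplex_moment \<gamma>)
      \<le> s\<^sup>2 * (\<Sum>\<alpha> | multidegree \<alpha> < L. (cmod (f \<alpha>))\<^sup>2 * simplex_moment \<alpha>)"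
proof -
  define A where "A = {\<alpha> :: 'n \<Rightarrow> nat. multidegree \<alpha> < L}"
  define B where "B = {\<gamma> :: 'n \<Rightarrow> nat. multidegree \<gamma> < L + d}"
  define C where "C \<gamma> \<alpha> = (\<Sum>\<delta>\<in>A0. if \<gamma> = (\<lambda>j. \<alpha> j + \<delta> j) then c \<delta> else 0)" for \<gamma> \<alpha>
  have fin: "finite A" "finite B"
    by (simp_all add: A_def B_def finite_multidegree_less)
  have mult: "(\<Sum>\<gamma>\<in>B. C \<gamma> \<alpha> * monomial \<gamma> z) = q z * monomial \<alpha> z" if "\<alpha> \<in> A" for \<alpha> z
  proof -
    have "(\<Sum>\<gamma>\<in>B. C \<gamma> \<alpha> * monomial \<gamma> z) =
        (\<Sum>\<delta>\<in>A0. \<Sum>\<gamma>\<in>B. if \<gamma> = (\<lambda>j. \<alpha> j + \<delta> j) then c \<delta> * monomial \<gamma> z else 0)"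
      unfolding C_def sum_distrib_right by (subst sum.swap) (auto intro!: sum.cong)
    also have "\<dots> = (\<Sum>\<delta>\<in>A0. c \<delta> * monomial (\<lambda>j. \<alpha> j + \<delta> j) z)"
    proof (rule sum.cong[OF refl])
      fix \<delta> assume "\<delta> \<in> A0"
      then have "(\<lambda>j. \<alpha> j + \<delta> j) \<in> B"
        using deg[of \<delta>] that by (auto simp: A_def B_def multidegree_def sum.distrib)
      then show "(\<Sum>\<gamma>\<in>B. if \<gamma> = (\<lambda>j. \<alpha> j + \<delta> j) then c \<delta> * monomial \<gamma> z else 0) =
          c \<delta> * monomial (\<lambda>j. \<alpha> j + \<delta> j) z"
        using fin by simp
    qed
    also have "\<dots> = q z * monomial \<alpha> z"
      by (simp add: q monomial_add sum_distrib_left sum_distrib_right mult_ac)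
    finally show ?thesis .
  qed
  have bound: "(\<Sum>\<gamma>\<in>B. (cmod (\<Sum>\<alpha>\<in>A. C \<gamma> \<alpha> * f \<alpha>))\<^sup>2 * simplex_moment \<gamma>)
      \<le> (\<Sum>\<alpha>\<in>A. (s\<^sup>2 * (cmod (f \<alpha>))\<^sup>2) * simplex_moment \<alpha>)" for f
  proof (rule simplex_moment_mono)
    fix t :: "'n \<Rightarrow> real"
    assume t: "\<And>j. 0 \<le> t j" "(\<Sum>j\<in>UNIV. t j) \<le> 1"
    define g where "g \<gamma> = (\<Sum>\<alpha>\<in>A. C \<gamma> \<alpha> * f \<alpha>)" for \<gamma>
    \<comment> \<open>Larger than every exponent occurring in \<open>B\<close>. The added 1 keeps
      \<open>M\<close> positive even for \<open>L + d = 0\<close>, so that its power can be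
      cancelled.\<close>
    define M where "M = L + d + 1"
    define z where "z \<theta> = (\<chi> j. of_real (sqrt (t j)) * cis (2 * pi * real (\<theta> j) / real M))" for \<theta> :: "'n \<Rightarrow> nat"
    have lt: "\<gamma> j < M" if "\<gamma> \<in> B" for \<gamma> :: "'n \<Rightarrow> nat" and j
      using that member_le_sum[of j UNIV \<gamma>] by (auto simp: B_def M_def multidegree_def)
    have AB: "A \<subseteq> B" by (auto simp: A_def B_def)
    have gz: "(\<Sum>\<gamma>\<in>B. g \<gamma> * monomial \<gamma> w) = q w * (\<Sum>\<alpha>\<in>A. f \<alpha> * monomial \<alpha> w)" for w
    proof -
      have "(\<Sum>\<gamma>\<in>B. g \<gamma> * monomial \<gamma> w) = (\<Sum>\<alpha>\<in>A. f \<alpha> * (\<Sum>\<gamma>\<in>B. C \<gamma> \<alpha> * monomial \<gamma> w))"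
        unfolding g_def sum_distrib_right sum_distrib_left by (subst sum.swap) (simp add: mult_ac)
      then show ?thesis
        by (simp add: mult sum_distrib_left mult_ac)
    qed
    have "norm (z \<theta>) \<le> 1" for \<theta>
    proof -
      have "(norm (z \<theta>))\<^sup>2 = (\<Sum>j\<in>UNIV. t j)"
        using t by (simp add: norm_vec_power2 z_def norm_mult)
      with t show ?thesis
        by (metis abs_norm_cancel abs_square_le_1)
    qed
    then have "(cmod (\<Sum>\<gamma>\<in>B. g \<gamma> * monomial \<gamma> (z \<theta>)))\<^sup>2 \<le>
        s\<^sup>2 * (cmod (\<Sum>\<alpha>\<in>A. f \<alpha> * monomial \<alpha> (z \<theta>)))\<^sup>2" for \<theta>
      unfolding gz norm_mult power_mult_distrib using bd[of "z \<theta>"]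
      by (intro mult_right_mono power_mono) auto
    then have "(\<Sum>\<theta>\<in>PiE UNIV (\<lambda>_. {..<M}). (cmod (\<Sum>\<gamma>\<in>B. g \<gamma> * monomial \<gamma> (z \<theta>)))\<^sup>2) \<le>
        s\<^sup>2 * (\<Sum>\<theta>\<in>PiE UNIV (\<lambda>_. {..<M}). (cmod (\<Sum>\<alpha>\<in>A. f \<alpha> * monomial \<alpha> (z \<theta>)))\<^sup>2)"
      unfolding sum_distrib_left by (intro sum_mono)
    also have "(\<Sum>\<theta>\<in>PiE UNIV (\<lambda>_. {..<M}). (cmod (\<Sum>\<gamma>\<in>B. g \<gamma> * monomial \<gamma> (z \<theta>)))\<^sup>2) =
        real M ^ CARD('n) * (\<Sum>\<gamma>\<in>B. (cmod (g \<gamma>))\<^sup>2 * (\<Prod>j\<in>UNIV. t j ^ \<gamma> j))"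
      unfolding z_def using lt t by (subst parseval_torus) auto
    also have "(\<Sum>\<theta>\<in>PiE UNIV (\<lambda>_. {..<M}). (cmod (\<Sum>\<alpha>\<in>A. f \<alpha> * monomial \<alpha> (z \<theta>)))\<^sup>2) =
        real M ^ CARD('n) * (\<Sum>\<alpha>\<in>A. (cmod (f \<alpha>))\<^sup>2 * (\<Prod>j\<in>UNIV. t j ^ \<alpha> j))"
      unfolding z_def using lt AB t by (subst parseval_torus) auto
    finally have "real M ^ CARD('n) * (\<Sum>\<gamma>\<in>B. (cmod (g \<gamma>))\<^sup>2 * (\<Prod>j\<in>UNIV. t j ^ \<gamma> j)) \<le>
        real M ^ CARD('n) * (s\<^sup>2 * (\<Sum>\<alpha>\<in>A. (cmod (f \<alpha>))\<^sup>2 * (\<Prod>j\<in>UNIV. t j ^ \<alpha> j)))"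
      by (simp add: mult_ac)
    then have "(\<Sum>\<gamma>\<in>B. (cmod (g \<gamma>))\<^sup>2 * (\<Prod>j\<in>UNIV. t j ^ \<gamma> j)) \<le>
        s\<^sup>2 * (\<Sum>\<alpha>\<in>A. (cmod (f \<alpha>))\<^sup>2 * (\<Prod>j\<in>UNIV. t j ^ \<alpha> j))"
      by (subst (asm) mult_le_cancel_left_pos) (auto simp: M_def)
    then show "(\<Sum>\<gamma>\<in>B. (cmod (\<Sum>\<alpha>\<in>A. C \<gamma> \<alpha> * f \<alpha>))\<^sup>2 * (\<Prod>j\<in>UNIV. t j ^ \<gamma> j)) \<le>
        (\<Sum>\<alpha>\<in>A. s\<^sup>2 * (cmod (f \<alpha>))\<^sup>2 * (\<Prod>j\<in>UNIV. t j ^ \<alpha> j))"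
      by (simp add: g_def sum_distrib_left mult.assoc)
  qed auto
  show thesis
    by (rule that[of C]) (use mult bound in \<open>auto simp: A_def B_def sum_distrib_left mult.assoc\<close>)
qed

text \<open>In the orthonormal basis \<open>e\<close>, multiplication by \<open>q\<close> has matrix
  \<open>T\<close> of norm at most \<open>s\<close>, and the transpose of \<open>T\<close> sends the
  vector of values \<open>e \<gamma> z\<close> to \<open>q z\<close> times the vector of values
  \<open>e \<alpha> z\<close>. Evaluating the contraction defect at that vector therefore gives the
  difference of kernels as a sum of squared moduli of polynomials.\<close>

lemma kernel_difference_decomposition:
  fixes q :: "complex ^ 'n \<Rightarrow> complex"
  assumes "finite A0" and q: "\<And>z. q z = (\<Sum>\<delta>\<in>A0. c \<delta> * monomial \<delta> z)"
    and deg: "\<And>\<delta>. \<delta> \<in> A0 \<Longrightarrow> multidegree \<delta> \<le> d"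
    and bd: "\<And>z. norm z \<le> 1 \<Longrightarrow> cmod (q z) \<le> s" and "s > 0"
  defines "K \<equiv> \<lambda>L r. \<Sum>k<L. fact (k + CARD('n)) / fact k * r ^ k"
  obtains N :: nat and g where "\<And>i. i < N \<Longrightarrow> holomorphic_polynomial (g i)"
    "\<And>z. (\<Sum>i<N. (cmod (g i z))\<^sup>2) = K (L + d) ((norm z)\<^sup>2) - (cmod (q z) / s)\<^sup>2 * K L ((norm z)\<^sup>2)"
proof -
  define A where "A = {\<alpha> :: 'n \<Rightarrow> nat. multidegree \<alpha> < L}"
  define B where "B = {\<gamma> :: 'n \<Rightarrow> nat. multidegree \<gamma> < L + d}"
  have fin: "finite A" "finite B"
    by (simp_all add: A_def B_def finite_multidegree_less)
  obtain C where C: "\<And>\<alpha> z. \<alpha> \<in> A \<Longrightarrow> (\<Sum>\<gamma>\<in>B. C \<gamma> \<alpha> * monomial \<gamma> z) = q z * monomial \<alpha> z"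
    and C_le: "\<And>f. (\<Sum>\<gamma>\<in>B. (cmod (\<Sum>\<alpha>\<in>A. C \<gamma> \<alpha> * f \<alpha>))\<^sup>2 * simplex_moment \<gamma>)
      \<le> s\<^sup>2 * (\<Sum>\<alpha>\<in>A. (cmod (f \<alpha>))\<^sup>2 * simplex_moment \<alpha>)"
    unfolding A_def B_def
    by (rule multiplication_bound[OF assms(1) q deg bd, where L = L]) auto
  define \<mu> where "\<mu> \<alpha> = complex_of_real (sqrt (simplex_moment \<alpha>))" for \<alpha> :: "'n \<Rightarrow> nat"
  define e where "e \<alpha> z = monomial \<alpha> z / \<mu> \<alpha>" for \<alpha> :: "'n \<Rightarrow> nat" and z
  define T where "T \<gamma> \<alpha> = C \<gamma> \<alpha> * \<mu> \<gamma> / \<mu> \<alpha>" for \<gamma> \<alpha>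
  have \<mu>: "\<mu> \<alpha> \<noteq> 0" "(cmod (\<mu> \<alpha>))\<^sup>2 = simplex_moment \<alpha>" for \<alpha>
    using simplex_moment_pos[of \<alpha>] by (auto simp: \<mu>_def)
  have kernel: "(\<Sum>\<alpha> | multidegree \<alpha> < l. (cmod (e \<alpha> z))\<^sup>2) = K l ((norm z)\<^sup>2)" for l z
    by (simp add: e_def norm_divide power_divide \<mu> sum_monomial_over_moment K_def)
  have T_le: "(\<Sum>\<gamma>\<in>B. (cmod (\<Sum>\<alpha>\<in>A. T \<gamma> \<alpha> * f \<alpha>))\<^sup>2) \<le> s\<^sup>2 * (\<Sum>\<alpha>\<in>A. (cmod (f \<alpha>))\<^sup>2)" for f
  proof -
    have "(\<Sum>\<alpha>\<in>A. T \<gamma> \<alpha> * f \<alpha>) = (\<Sum>\<alpha>\<in>A. C \<gamma> \<alpha> * (f \<alpha> / \<mu> \<alpha>)) * \<mu> \<gamma>" for \<gamma>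
      by (simp add: T_def sum_distrib_left sum_distrib_right mult_ac)
    then show ?thesis
      using C_le[of "\<lambda>\<alpha>. f \<alpha> / \<mu> \<alpha>"]
      by (simp add: norm_mult norm_divide power_mult_distrib power_divide \<mu>
          less_imp_neq[OF simplex_moment_pos, symmetric])
  qed
  obtain v where v: "\<And>x. (\<Sum>\<gamma>\<in>B. (cmod (x \<gamma>))\<^sup>2) - (\<Sum>\<alpha>\<in>A. (cmod (\<Sum>\<gamma>\<in>B. T \<gamma> \<alpha> * x \<gamma>))\<^sup>2) / s\<^sup>2
      = (\<Sum>i\<in>B. (cmod (\<Sum>\<gamma>\<in>B. v i \<gamma> * x \<gamma>))\<^sup>2)"
    using contraction_defect_decomposition[OF fin(2) \<open>s > 0\<close> T_le] by blast
  \<comment> \<open>Numbers the components, which so far are indexed by multi-indices.\<close>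
  obtain \<beta> where \<beta>: "bij_betw \<beta> {..<card B} B"
    using ex_bij_betw_nat_finite[OF fin(2)] by (auto simp: atLeast0LessThan)
  show thesis
  proof (rule that)
    show "holomorphic_polynomial (\<lambda>z. \<Sum>\<gamma>\<in>B. v (\<beta> i) \<gamma> * e \<gamma> z)" for i
      unfolding holomorphic_polynomial_def e_def monomial_def
      by (rule exI[of _ B], rule exI[of _ "\<lambda>\<gamma>. v (\<beta> i) \<gamma> / \<mu> \<gamma>"]) (simp add: fin)
    show "(\<Sum>i<card B. (cmod (\<Sum>\<gamma>\<in>B. v (\<beta> i) \<gamma> * e \<gamma> z))\<^sup>2) =
        K (L + d) ((norm z)\<^sup>2) - (cmod (q z) / s)\<^sup>2 * K L ((norm z)\<^sup>2)" for z
    proof -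
      have "(\<Sum>\<gamma>\<in>B. T \<gamma> \<alpha> * e \<gamma> z) = q z * e \<alpha> z" if "\<alpha> \<in> A" for \<alpha>
      proof -
        have "(\<Sum>\<gamma>\<in>B. T \<gamma> \<alpha> * e \<gamma> z) = (\<Sum>\<gamma>\<in>B. C \<gamma> \<alpha> * monomial \<gamma> z) / \<mu> \<alpha>"
          using \<mu> by (simp add: T_def e_def sum_divide_distrib)
        then show ?thesis by (simp add: C[OF that] e_def)
      qed
      then have "(\<Sum>\<alpha>\<in>A. (cmod (\<Sum>\<gamma>\<in>B. T \<gamma> \<alpha> * e \<gamma> z))\<^sup>2) = (cmod (q z))\<^sup>2 * (\<Sum>\<alpha>\<in>A. (cmod (e \<alpha> z))\<^sup>2)"
        by (simp add: norm_mult power_mult_distrib sum_distrib_left)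
      moreover have "(\<Sum>i<card B. (cmod (\<Sum>\<gamma>\<in>B. v (\<beta> i) \<gamma> * e \<gamma> z))\<^sup>2) =
          (\<Sum>i\<in>B. (cmod (\<Sum>\<gamma>\<in>B. v i \<gamma> * e \<gamma> z))\<^sup>2)"
        by (rule sum.reindex_bij_betw[OF \<beta>])
      ultimately show ?thesis
        using v[of "\<lambda>\<gamma>. e \<gamma> z"] by (simp add: A_def B_def kernel power_divide)
    qed
  qed
qed

section \<open>Construction of the proper map\<close>

text \<open>The hockey-stick identity for binomial coefficients, scaled by \<open>n!\<close>. It
  compares the next weight with the sum of the preceding ones.\<close>

lemma kernel_weight_sum:
  "real (n + 1) * (\<Sum>k<L. fact (k + n) / fact k) = real L * (fact (L + n) / fact L)"
proof (induction L)
  case (Suc L)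
  have "real (n + 1) * (\<Sum>k<Suc L. fact (k + n) / fact k) = real (L + n + 1) * (fact (L + n) / fact L)"
    using Suc by (simp add: distrib_left distrib_right add_divide_distrib)
  also have "\<dots> = real (Suc L) * (fact (Suc L + n) / fact (Suc L))"
    by (simp add: divide_simps)
  finally show ?case .
qed simp

text \<open>By \<open>kernel_weight_sum\<close>, appending the term of index \<open>L + d\<close>
  multiplies the sum by \<open>1 + (n + 1) / (L + d)\<close>, which is at most
  \<open>1 + (n + 1) / L\<close>.\<close>

lemma kernel_weight_sum_growth:
  assumes "L > 0"
  shows "(\<Sum>k<L + d. fact (k + n) / fact k) \<le>
    (\<Sum>k<L. fact (k + n) / fact k) * (1 + real (n + 1) / real L) ^ d"
proof (induction d)
  case (Suc d)
  define D :: "nat \<Rightarrow> real" where "D L = (\<Sum>k<L. fact (k + n) / fact k)" for L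
  have "D (L + d) \<ge> 0" by (simp add: D_def sum_nonneg)
  have "fact (L + d + n) / fact (L + d) = D (L + d) * (real (n + 1) / real (L + d))"
    using kernel_weight_sum[where n = n and L = "L + d"] assms by (simp add: D_def field_simps)
  then have "D (L + Suc d) = D (L + d) * (1 + real (n + 1) / real (L + d))"
    by (simp add: D_def distrib_left)
  also have "\<dots> \<le> D (L + d) * (1 + real (n + 1) / real L)"
    using assms \<open>D (L + d) \<ge> 0\<close> by (intro mult_left_mono add_left_mono divide_left_mono) auto
  also have "\<dots> \<le> D L * (1 + real (n + 1) / real L) ^ d * (1 + real (n + 1) / real L)"
    using Suc by (intro mult_right_mono) (auto simp: D_def)
  finally show ?case by (simp add: D_def mult_ac)
qed simp

text \<open>For fixed \<open>d\<close> the growth factor tends to 1, which is below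
  \<open>1 / s\<close>. Taking \<open>L \<ge> 2\<close> keeps the linear term in the kernel, which
  later gives strict inequality inside the ball.\<close>

lemma kernel_weight_sum_ratio:
  fixes s :: real
  assumes "0 < s" "s < 1"
  obtains L where "L \<ge> 2"
    "s * (\<Sum>k<L + d. fact (k + n) / fact k) \<le> (\<Sum>k<L. fact (k + n) / fact k)"
proof -
  have "(\<lambda>L. (1 + real (n + 1) / real L) ^ d) \<longlonglongrightarrow> (1 + 0) ^ d"
    by (intro tendsto_intros lim_const_over_n)
  moreover have "(1 + 0) ^ d < 1 / s" using assms by simp
  ultimately have "eventually (\<lambda>L. (1 + real (n + 1) / real L) ^ d < 1 / s) sequentially"
    by (rule order_tendstoD)
  then obtain L where L: "L \<ge> 2" "(1 + real (n + 1) / real L) ^ d < 1 / s"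
    using eventually_happens[OF eventually_conj[OF _ eventually_ge_at_top[of 2]]]
    by (metis (no_types, lifting) trivial_limit_sequentially)
  let ?D = "\<lambda>L. \<Sum>k<L. fact (k + n) / fact k :: real"
  have "?D (L + d) \<le> ?D L * (1 + real (n + 1) / real L) ^ d"
    using L by (intro kernel_weight_sum_growth) auto
  also have "\<dots> \<le> ?D L * (1 / s)"
    using L by (intro mult_left_mono) (auto intro!: sum_nonneg)
  finally have "s * ?D (L + d) \<le> ?D L"
    using assms by (simp add: field_simps)
  with L show thesis by (intro that)
qed

section \<open>Holomorphic polynomials: closure properties, continuity, surjectivity\<close>

lemma holomorphic_polynomial_scale:
  assumes "holomorphic_polynomial f"
  shows "holomorphic_polynomial (\<lambda>z. k * f z)"
proof -
  obtain A c where "finite A" "f = (\<lambda>z. \<Sum>\<alpha>\<in>A. c \<alpha> * (\<Prod>j\<in>UNIV. (z $ j) ^ \<alpha> j))"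
    using assms unfolding holomorphic_polynomial_def by blast
  then show ?thesis
    unfolding holomorphic_polynomial_def
    by (intro exI[of _ A] exI[of _ "\<lambda>\<alpha>. k * c \<alpha>"]) (simp add: sum_distrib_left mult_ac)
qed

lemma holomorphic_polynomial_const_add:
  assumes "holomorphic_polynomial f"
  shows "holomorphic_polynomial (\<lambda>z. k + f z)"
proof -
  obtain A c where A: "finite A" "f = (\<lambda>z. \<Sum>\<alpha>\<in>A. c \<alpha> * (\<Prod>j\<in>UNIV. (z $ j) ^ \<alpha> j))"
    using assms unfolding holomorphic_polynomial_def by blast
  \<comment> \<open>The zero multi-index may already belong to \<open>A\<close>, so the new constant
    is added to the old coefficient, read as 0 outside \<open>A\<close>.\<close>
  define c' where "c' \<alpha> = (if \<alpha> = (\<lambda>_. 0) then k else 0) + (if \<alpha> \<in> A then c \<alpha> else 0)" for \<alpha>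
  have "k + f z = (\<Sum>\<alpha>\<in>insert (\<lambda>_. 0) A. c' \<alpha> * (\<Prod>j\<in>UNIV. (z $ j) ^ \<alpha> j))" for z
  proof -
    have "(\<Sum>\<alpha>\<in>insert (\<lambda>_. 0) A. (if \<alpha> = (\<lambda>_. 0) then k else 0) * (\<Prod>j\<in>UNIV. (z $ j) ^ \<alpha> j)) = k"
    proof -
      have "(\<Sum>\<alpha>\<in>insert (\<lambda>_. 0) A. (if \<alpha> = (\<lambda>_. 0) then k else 0) * (\<Prod>j\<in>UNIV. (z $ j) ^ \<alpha> j)) =
          (\<Sum>\<alpha>\<in>insert (\<lambda>_. 0) A. if \<alpha> = (\<lambda>_. 0) then k else 0)"
        by (intro sum.cong) auto
      also have "\<dots> = k"
        using A(1) by (subst sum.delta) auto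
      finally show ?thesis .
    qed
    moreover have "(\<Sum>\<alpha>\<in>insert (\<lambda>_. 0) A. (if \<alpha> \<in> A then c \<alpha> else 0) * (\<Prod>j\<in>UNIV. (z $ j) ^ \<alpha> j)) = f z"
      unfolding A(2) using A(1) by (intro sum.mono_neutral_cong_right) auto
    ultimately show ?thesis
      by (simp add: c'_def distrib_right sum.distrib del: sum.insert)
  qed
  then show ?thesis
    unfolding holomorphic_polynomial_def using A(1)
    by (intro exI[of _ "insert (\<lambda>_. 0) A"] exI[of _ c']) auto
qed

lemma holomorphic_polynomial_continuous_on:
  assumes "holomorphic_polynomial f"
  shows "continuous_on S f"
proof -
  obtain A c where "finite A" "f = (\<lambda>z. \<Sum>\<alpha>\<in>A. c \<alpha> * (\<Prod>j\<in>UNIV. (z $ j) ^ \<alpha> j))"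
    using assms unfolding holomorphic_polynomial_def by blast
  then show ?thesis by (auto intro!: continuous_intros)
qed

text \<open>On the complex line through 0 and \<open>z\<close> the polynomial is a nonconstant
  polynomial in one variable, so the fundamental theorem of algebra applies.\<close>

lemma holomorphic_polynomial_surj:
  fixes q :: "complex ^ 'n \<Rightarrow> complex"
  assumes "holomorphic_polynomial q" "q z \<noteq> q 0"
  obtains x where "q x = w"
proof -
  obtain A c where A: "finite A" "q = (\<lambda>z. \<Sum>\<alpha>\<in>A. c \<alpha> * monomial \<alpha> z)"
    using assms unfolding holomorphic_polynomial_def monomial_def by blast
  define P where "P = (\<Sum>\<alpha>\<in>A. monom (c \<alpha> * monomial \<alpha> z) (multidegree \<alpha>)) - [:w:]"
  have P: "poly P t = q (t *s z) - w" for t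
    by (simp add: P_def A(2) poly_sum poly_monom monomial_def multidegree_def power_mult_distrib
        prod.distrib power_sum mult_ac)
  have "poly P 1 \<noteq> poly P 0"
    using assms(2) by (simp add: P)
  then have "\<not> constant (poly P)"
    unfolding constant_def by blast
  then obtain t where "poly P t = 0"
    using fundamental_theorem_of_algebra by blast
  then show thesis
    using that P by auto
qed

section \<open>The numerator and the proper map\<close>

lemma spherical_numerator:
  fixes q :: "complex ^ 'n \<Rightarrow> complex" and s :: real
  assumes poly: "holomorphic_polynomial q" and s: "0 < s" "s < 1"
    and bd: "\<And>z. norm z \<le> 1 \<Longrightarrow> cmod (q z) < s"
  obtains N :: nat and p where "0 < N" "\<And>i. i < N \<Longrightarrow> holomorphic_polynomial (p i)"
    "p 0 = (\<lambda>z. of_real (sqrt s) + q z / of_real (sqrt s))"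
    "\<And>z. norm z = 1 \<Longrightarrow> (\<Sum>i<N. (cmod (p i z))\<^sup>2) = (cmod (1 + q z))\<^sup>2"
    "\<And>z. norm z < 1 \<Longrightarrow> (\<Sum>i<N. (cmod (p i z))\<^sup>2) < (cmod (1 + q z))\<^sup>2"
proof -
  obtain A c where A: "finite A" "q = (\<lambda>z. \<Sum>\<alpha>\<in>A. c \<alpha> * monomial \<alpha> z)"
    using poly unfolding holomorphic_polynomial_def monomial_def by blast
  define d where "d = Max (insert 0 (multidegree ` A))"
  have deg: "multidegree \<delta> \<le> d" if "\<delta> \<in> A" for \<delta>
    unfolding d_def using that A(1) by (intro Max_ge) auto
  define n where "n = CARD('n)"
  define K :: "nat \<Rightarrow> real \<Rightarrow> real" where "K L r = (\<Sum>k<L. fact (k + n) / fact k * r ^ k)" for L r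
  obtain L where "L \<ge> 2" "s * (\<Sum>k<L + d. fact (k + n) / fact k) \<le> (\<Sum>k<L. fact (k + n) / fact k)"
    by (rule kernel_weight_sum_ratio[OF s])
  then have L: "L \<ge> 2" "s * K (L + d) 1 \<le> K L 1"
    by (simp_all add: K_def)
  define D where "D = K L 1"
  define D' where "D' = K (L + d) 1"
  have "D' > 0"
    using L(1) unfolding D'_def K_def by (intro sum_pos) (auto simp: lessThan_empty_iff)
  obtain N :: nat and g where g: "\<And>i. i < N \<Longrightarrow> holomorphic_polynomial (g i)"
    and sum_g: "\<And>z. (\<Sum>i<N. (cmod (g i z))\<^sup>2) =
      K (L + d) ((norm z)\<^sup>2) - (cmod (q z) / s)\<^sup>2 * K L ((norm z)\<^sup>2)"
    by (rule kernel_difference_decomposition[OF A(1) A(2)[THEN fun_cong] deg less_imp_le[OF bd] s(1),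
          folded n_def, folded K_def, where L = L]) auto
  \<comment> \<open>On the sphere the squared norm of \<open>g\<close> is
    \<open>D' - |q|^2 * D / s^2\<close>. Matching the constant terms of the two sides requires
    \<open>s + a * D' = 1\<close>; matching the coefficients of \<open>|q|^2\<close> requires
    \<open>1 / s + b - a * D / s^2 = 1\<close>, which determines \<open>b\<close>.\<close>
  define a where "a = (1 - s) / D'"
  define b where "b = a * (D - s * D') / s\<^sup>2"
  have "a > 0" using s \<open>D' > 0\<close> by (simp add: a_def)
  have "b \<ge> 0" using \<open>a > 0\<close> L(2) by (simp add: b_def D_def D'_def)
  \<comment> \<open>The automorphism \<open>w \<mapsto> (w\<^sub>0 + \<surd>s, \<surd>(1 - s) w') / (1 + \<surd>s w\<^sub>0)\<close> of the ball, with its denominator cleared,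
    applied to \<open>q / \<surd>s\<close> together with the components \<open>g\<close> that complete it to a map into the sphere.
    The multiple of \<open>q\<close> absorbs the slack in \<open>s * D' \<le> D\<close>.\<close>
  define p where "p i = (case i of 0 \<Rightarrow> (\<lambda>z. of_real (sqrt s) + q z / of_real (sqrt s))
      | Suc 0 \<Rightarrow> (\<lambda>z. of_real (sqrt b) * q z) | Suc (Suc i) \<Rightarrow> (\<lambda>z. of_real (sqrt a) * g i z))" for i
  \<comment> \<open>An identity at every \<open>z\<close>: both kernel differences vanish on the
    sphere, and inside the ball the first dominates the second.\<close>
  have p_sum: "(cmod (1 + q z))\<^sup>2 - (\<Sum>i<N + 2. (cmod (p i z))\<^sup>2) =
      a * ((D' - K (L + d) ((norm z)\<^sup>2)) - (cmod (q z) / s)\<^sup>2 * (D - K L ((norm z)\<^sup>2)))" for z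
  proof -
    define Q where "Q = (cmod (q z))\<^sup>2"
    define t where "t = (cmod (q z) / s)\<^sup>2"
    have t: "t = Q / s\<^sup>2" by (simp add: t_def Q_def power_divide)
    have p: "(\<Sum>i<N + 2. (cmod (p i z))\<^sup>2) =
        (cmod (of_real (sqrt s) + q z / of_real (sqrt s)))\<^sup>2 + b * Q + a * (\<Sum>i<N. (cmod (g i z))\<^sup>2)"
      using \<open>a > 0\<close> \<open>b \<ge> 0\<close>
      by (simp add: p_def sum.lessThan_Suc_shift norm_mult power_mult_distrib sum_distrib_left Q_def
          del: sum.lessThan_Suc)
    have p0: "(cmod (of_real (sqrt s) + q z / of_real (sqrt s)))\<^sup>2 = s + 2 * Re (q z) + Q / s"
    proof -
      have "Re (q z) / sqrt s * sqrt s = Re (q z)" using s by simp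
      moreover have "(Re (q z) / sqrt s)\<^sup>2 + (Im (q z) / sqrt s)\<^sup>2 = Q / s"
        using s by (simp add: Q_def cmod_power2 power_divide add_divide_distrib)
      ultimately show ?thesis
        using s by (simp add: cmod_power2 power2_sum)
    qed
    have q1: "(cmod (1 + q z))\<^sup>2 = 1 + 2 * Re (q z) + Q"
      by (simp add: Q_def cmod_power2 power2_sum)
    have "1 + Q - s - Q / s = a * (D' - t * (s * D'))"
      using s \<open>D' > 0\<close> by (simp add: a_def t field_simps power2_eq_square)
    moreover have "b * Q = a * (t * (D - s * D'))"
      by (simp add: b_def t)
    ultimately show ?thesis
      unfolding p p0 q1 sum_g t_def[symmetric] by (simp add: algebra_simps)
  qed
  show thesis
  proof (rule that[of "N + 2" p])
    show "holomorphic_polynomial (p i)" if "i < N + 2" for i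
      using that g poly holomorphic_polynomial_const_add[OF holomorphic_polynomial_scale[OF poly],
          of "of_real (sqrt s)" "1 / of_real (sqrt s)"]
      by (auto simp: p_def split: nat.split intro!: holomorphic_polynomial_scale)
    show "(\<Sum>i<N + 2. (cmod (p i z))\<^sup>2) = (cmod (1 + q z))\<^sup>2" if "norm z = 1" for z
      using p_sum[of z] that by (simp add: D_def D'_def del: sum.lessThan_Suc)
    show "(\<Sum>i<N + 2. (cmod (p i z))\<^sup>2) < (cmod (1 + q z))\<^sup>2" if "norm z < 1" for z
    proof -
      define r where "r = (norm z)\<^sup>2"
      have r: "0 \<le> r" "r < 1"
        using that by (auto simp: r_def abs_square_less_1)
      have diff: "K l 1 - K l r = (\<Sum>k<l. fact (k + n) / fact k * (1 - r ^ k))" for l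
        by (simp add: K_def right_diff_distrib flip: sum_subtractf)
      have nonneg: "0 \<le> fact (k + n) / fact k * (1 - r ^ k)" for k
        using r by (intro mult_nonneg_nonneg) (auto simp: power_le_one)
      have "0 < D - K L r"
        \<comment> \<open>The term \<open>k = 0\<close> vanishes; the term \<open>k = 1\<close> is
          positive and is present because \<open>L \<ge> 2\<close>.\<close>
        unfolding D_def diff using L(1) r nonneg
        by (intro sum_pos2[where i = 1]) auto
      moreover have "(cmod (q z) / s)\<^sup>2 < 1"
        using bd[of z] that s by (simp add: abs_square_less_1)
      ultimately have "(cmod (q z) / s)\<^sup>2 * (D - K L r) < D - K L r"
        by simp
      also have "\<dots> \<le> D' - K (L + d) r"
        unfolding D_def D'_def diff using nonneg by (intro sum_mono2) auto
      finally have "0 < a * ((D' - K (L + d) r) - (cmod (q z) / s)\<^sup>2 * (D - K L r))"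
        using \<open>a > 0\<close> by simp
      then show ?thesis
        using p_sum[of z] by (simp add: r_def del: sum.lessThan_Suc)
    qed
  qed (auto simp: p_def)
qed

theorem theorem4:
  fixes q :: "complex ^ 'n \<Rightarrow> complex"
  assumes "holomorphic_polynomial q"
    and "q 0 = 0"
    and "\<And>z. z \<in> cball 0 1 \<Longrightarrow> cmod (q z) < 1"
  shows "\<exists>N p. holomorphic_polynomial_mapping N p \<and>
           continuous_map (top_of_set (ball 0 1)) (top_of_set (complex_ball N))
             (\<lambda>z i. p z i / (1 + q z)) \<and>
           proper_map (top_of_set (ball 0 1)) (top_of_set (complex_ball N))
             (\<lambda>z i. p z i / (1 + q z)) \<and>
           (q \<noteq> (\<lambda>z. 0) \<longrightarrow>
             \<not> (\<forall>i<N. polynomial_divides (\<lambda>z. 1 + q z) (\<lambda>z. p z i)))"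
proof -
  have cont_q: "continuous_on S q" for S
    by (rule holomorphic_polynomial_continuous_on[OF assms(1)])
  obtain m where m: "m \<in> cball 0 1" "\<And>z. z \<in> cball 0 1 \<Longrightarrow> cmod (q z) \<le> cmod (q m)"
    using continuous_attains_sup[OF compact_cball _ continuous_on_norm[OF cont_q], of 0 1] by auto
  \<comment> \<open>The midpoint of 1 and the maximum of |q| on the closed ball, hence positive even
    for \<open>q = 0\<close>.\<close>
  define s where "s = (1 + cmod (q m)) / 2"
  have s: "0 < s" "s < 1" "cmod (q m) < s"
    using assms(3)[OF m(1)] by (auto simp: s_def add_pos_nonneg)
  have bd: "cmod (q z) < s" if "norm z \<le> 1" for z
    using m(2)[of z] that s(3) by simp
  obtain N :: nat and f where N: "0 < N" and f: "\<And>i. i < N \<Longrightarrow> holomorphic_polynomial (f i)"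
    and f0: "f 0 = (\<lambda>z. of_real (sqrt s) + q z / of_real (sqrt s))"
    and sphere: "\<And>z. norm z = 1 \<Longrightarrow> (\<Sum>i<N. (cmod (f i z))\<^sup>2) = (cmod (1 + q z))\<^sup>2"
    and ball: "\<And>z. norm z < 1 \<Longrightarrow> (\<Sum>i<N. (cmod (f i z))\<^sup>2) < (cmod (1 + q z))\<^sup>2"
    using spherical_numerator[OF assms(1) s(1,2) bd] by blast
  define p where "p z i = (if i < N then f i z else 0)" for z i
  define F where "F = (\<lambda>z i. p z i / (1 + q z))"
  have nz: "1 + q z \<noteq> 0" if "norm z \<le> 1" for z
  proof
    assume "1 + q z = 0"
    then have "cmod (q z) = 1" by (metis add_eq_0_iff norm_minus_cancel norm_one)
    with assms(3)[of z] that show False by simp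
  qed
  have F_space: "F z \<in> complex_space N" for z
    by (simp add: F_def p_def complex_space_def)
  have F_sum: "(\<Sum>i<N. (cmod (F z i))\<^sup>2) = (\<Sum>i<N. (cmod (f i z))\<^sup>2) / (cmod (1 + q z))\<^sup>2" for z
    by (simp add: F_def p_def norm_divide power_divide sum_divide_distrib)
  \<comment> \<open>Also covers the sphere, where \<open>F\<close> has squared norm exactly 1 and so
    leaves the open target ball.\<close>
  have F_ball: "F z \<in> complex_ball N \<longleftrightarrow> norm z < 1" if "norm z \<le> 1" for z
    using that nz[of z] sphere[of z] ball[of z] F_space[of z]
    by (cases "norm z < 1") (auto simp: complex_ball_def F_sum)
  have cont_F: "continuous_on (cball 0 1) F"
  proof (rule continuous_on_coordinatewise_then_product)
    fix i
    have "continuous_on (cball 0 1) (\<lambda>z. p z i)"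
      using holomorphic_polynomial_continuous_on[OF f] by (cases "i < N") (auto simp: p_def)
    then show "continuous_on (cball 0 1) (\<lambda>z. F z i)"
      unfolding F_def using nz by (auto intro!: continuous_intros cont_q)
  qed
  have cont: "continuous_map (top_of_set (ball 0 1)) (top_of_set (complex_ball N)) F"
    using continuous_on_subset[OF cont_F ball_subset_cball] F_ball
    by (auto simp: continuous_map_in_subtopology)
  have proper: "proper_map (top_of_set (ball 0 1)) (top_of_set (complex_ball N)) F"
    unfolding proper_map_complex_ball_iff[OF cont]
  proof (intro allI impI)
    fix C assume C: "C \<subseteq> complex_ball N \<and> compact C"
    \<comment> \<open>No point of the sphere maps into \<open>C\<close>, so the preimage may be
      taken in the closed ball. There it is closed by continuity up to the boundary, hence
      compact.\<close>
    have "{z \<in> ball 0 1. F z \<in> C} = cball 0 1 \<inter> F -` C"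
      using C F_ball by auto
    moreover have "closed (cball 0 1 \<inter> F -` C)"
      using C by (intro continuous_closed_preimage[OF cont_F]) (auto intro: compact_imp_closed)
    ultimately show "compact {z \<in> ball 0 1. F z \<in> C}"
      by (metis compact_cball compact_Int_closed inf.left_idem)
  qed
  have lowest: "\<not> polynomial_divides (\<lambda>z. 1 + q z) (\<lambda>z. p z 0)" if "q \<noteq> (\<lambda>z. 0)"
  proof
    assume "polynomial_divides (\<lambda>z. 1 + q z) (\<lambda>z. p z 0)"
    then obtain h where h: "\<And>z. p z 0 = (1 + q z) * h z"
      unfolding polynomial_divides_def by meson
    obtain z where "q z \<noteq> q 0" using \<open>q \<noteq> (\<lambda>z. 0)\<close> unfolding assms(2) fun_eq_iff by blast
    \<comment> \<open>At a zero of \<open>1 + q\<close> divisibility would make the first numerator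
      vanish, but its value there is \<open>sqrt s - 1 / sqrt s\<close>, which is nonzero as
      \<open>s < 1\<close>.\<close>
    then obtain x where "q x = - 1"
      using holomorphic_polynomial_surj[OF assms(1)] by blast
    with h[of x] N have "complex_of_real (sqrt s) = 1 / of_real (sqrt s)"
      by (simp add: p_def f0)
    then have "sqrt s * sqrt s = 1"
      using s by (simp add: field_simps flip: of_real_mult)
    with s show False by simp
  qed
  show ?thesis
  proof (intro exI conjI)
    show "holomorphic_polynomial_mapping N p"
      using f by (auto simp: holomorphic_polynomial_mapping_def complex_space_def p_def)
    show "q \<noteq> (\<lambda>z. 0) \<longrightarrow> \<not> (\<forall>i<N. polynomial_divides (\<lambda>z. 1 + q z) (\<lambda>z. p z i))"
      using lowest N by blast
  qed (use cont proper in \<open>auto simp: F_def\<close>)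
qed

end
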